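(* Let $\mathbb{D} = \{z \in \mathbb{C} : |z| \le 1\}$ with symplectic form $\omega = \frac{i}{2} dz \wedge d\overline{z}$, let $\mathcal{G} = Ham_c(\mathbb{D},\omega)$ be its group of compactly supported Hamiltonian diffeomorphisms, let $Cal : \mathcal{G} \to \mathbb{R}$ be the Calabi homomorphism and let $\Phi : \mathcal{G} \to \mathbb{R}$ be the average rotation number homomorphism. Then $$\Phi = -2\, Cal$$ as homomorphisms $\mathcal{G} \to \mathbb{R}$. That is, for every $\phi \in \mathcal{G}$ and every Hamiltonian isotopy $\{\phi_t\}_{t\in[0,1]}$ with $\phi_0 = \mathrm{id}$, $\phi_1 = \phi$, generated by a normalized Hamiltonian $H_t$ (zero near $\partial\mathbb{D}$), $$\int_{X_2} dm^2(x) \int_{\{\phi_t\cdot x\}} \theta \;=\; -2 \int_0^1 dt \int_{\mathbb{D}} H_t\, \omega .$$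
   Context: Hamiltonian isotopies: $H_t$, $t \in [0,1]$, is a smooth time-dependent real-valued function on $\mathbb{D}$ that vanishes near the boundary $\partial \mathbb{D}$ (on a neighborhood of $\partial\mathbb{D}$ independent of $t$); this is the normalization of the Hamiltonian. Its time-dependent vector field $X_t$ is defined by the sign convention $\iota_{X_t}\omega = -dH_t$, and $\{\phi_t\}_{t\in[0,1]}$ is the flow of $X_t$ with $\phi_0 = \mathrm{id}$, i.e. $\frac{d}{dt}\phi_t(z) = X_t(\phi_t(z))$. The group $\mathcal{G} = Ham_c(\mathbb{D},\omega)$ consists of all time-one maps $\phi = \phi_1$ of such isotopies. Calabi homomorphism: $Cal(\phi) = \int_0^1 dt \int_{\mathbb{D}} H_t\,\omega$, for any Hamiltonian isotopy $\{\phi_t\}_{t\in[0,1]}$ with $\phi_0=\mathrm{id}$ and $\phi_1=\phi$ that is the flow of the vector field $X_t$ given by $\iota_{X_t}\omega = -dH_t$, where $H_t$ is a smooth time-dependent real-valued function on $\mathbb{D}$ vanishing near $\partial\mathbb{D}$. It is a homomorphism $\mathcal{G}\to\mathbb{R}$ whose value does not depend on the choice of isotopy. Average rotation number: let $X_2 = \{(z_1,z_2) : z_1,z_2 \in \mathbb{D},\ z_1 \neq z_2\}$, and on $X_2$ consider the closed complex-valued 1-form $\alpha = \frac{1}{2\pi}\frac{d(z_1-z_2)}{z_1-z_2}$ and its imaginary part $\theta = \mathrm{Im}(\alpha)$. For $x = (z_1,z_2)\in X_2$, $\{\phi_t\cdot x\}$ denotes the curve $t \mapsto (\phi_t(z_1),\phi_t(z_2))$,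 $t\in[0,1]$, in $X_2$. Let $dm$ be Lebesgue measure on $\mathbb{D}$ and $dm^2(x) = dm(z_1)\,dm(z_2)$ the Lebesgue measure on $\mathbb{D}\times\mathbb{D}$ restricted to $X_2$. Then $$\Phi(\phi) = \int_{X_2} dm^2(x)\int_{\{\phi_t\cdot x\}}\theta ,$$ which is a homomorphism $\mathcal{G} \to \mathbb{R}$. *)

theory Defs
  imports "HOL-Analysis.Analysis"
begin

abbreviation disc :: "complex set" where
  "disc \<equiv> cball 0 1"

primrec Ck_on :: "nat \<Rightarrow> ('a::euclidean_space \<Rightarrow> 'b::euclidean_space) \<Rightarrow> 'a set \<Rightarrow> bool" where
  "Ck_on 0 f U \<longleftrightarrow> continuous_on U f"
| "Ck_on (Suc k) f U \<longleftrightarrow> (\<forall>x\<in>U. f differentiable at x) \<and>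
     (\<forall>v. Ck_on k (\<lambda>x. frechet_derivative f (at x) v) U)"

text \<open>Smoothness on an arbitrary set \<open>S\<close>, such as the closed cylinder \<open>{0..1} \<times> disc\<close>,
  means having a \<open>C\<^sup>\<infinity>\<close> extension to an open neighbourhood of \<open>S\<close>.\<close>

definition smooth_on :: "'a::euclidean_space set \<Rightarrow> ('a \<Rightarrow> 'b::euclidean_space) \<Rightarrow> bool" where
  "smooth_on S f \<longleftrightarrow>
     (\<exists>U g. open U \<and> S \<subseteq> U \<and> (\<forall>k. Ck_on k g U) \<and> (\<forall>x\<in>S. g x = f x))"

text \<open>The form \<open>\<omega> = (\<i>/2) dz \<and> d(cnj z)\<close>, which has constant coefficients, as a bilinear form on
  tangent vectors. The wedge convention is \<open>(a \<and> b)(u, v) = a(u) b(v) - a(v) b(u)\<close>. The complex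
  number under \<^const>\<open>Re\<close> is always real (see \<open>omega_real\<close>).\<close>

definition omega :: "complex \<Rightarrow> complex \<Rightarrow> real" where
  "omega u v = Re (\<i> / 2 * (u * cnj v - v * cnj u))"

lemma omega_real: "complex_of_real (omega u v) = \<i> / 2 * (u * cnj v - v * cnj u)"
  by (simp add: omega_def complex_eq_iff)

lemma omega_eq_det: "omega u v = Re u * Im v - Im u * Re v"
  by (simp add: omega_def)

text \<open>Integral of a 2-form over a planar region with the standard orientation, i.e. with
  \<open>(1, \<i>)\<close> as oriented basis of the tangent space.\<close>

definition integral_2form :: "complex set \<Rightarrow> (complex \<Rightarrow> complex \<Rightarrow> complex \<Rightarrow> real) \<Rightarrow> real" where
  "integral_2form S \<eta> = (LINT z:S|lborel. \<eta> z 1 \<i>)"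

definition line_integral :: "('a::real_normed_vector \<Rightarrow> 'a \<Rightarrow> real) \<Rightarrow> (real \<Rightarrow> 'a) \<Rightarrow> real" where
  "line_integral \<eta> \<gamma> =
     (LINT t:{0..1}|lborel. \<eta> (\<gamma> t) (vector_derivative \<gamma> (at t within {0..1})))"

definition normalized_hamiltonian :: "(real \<Rightarrow> complex \<Rightarrow> real) \<Rightarrow> bool" where
  "normalized_hamiltonian H \<longleftrightarrow>
     smooth_on ({0..1} \<times> disc) (\<lambda>(t, z). H t z) \<and>
     (\<exists>V. open V \<and> sphere 0 1 \<subseteq> V \<and> (\<forall>t\<in>{0..1}. \<forall>z\<in>V \<inter> disc. H t z = 0))"

text \<open>The condition \<open>\<iota>\<^bsub>X\<^esub> \<omega> = - dH\<close>, written as \<open>dH = - \<iota>\<^bsub>X\<^esub> \<omega>\<close>.\<close>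

definition hamiltonian_vector_field ::
  "(real \<Rightarrow> complex \<Rightarrow> real) \<Rightarrow> (real \<Rightarrow> complex \<Rightarrow> complex) \<Rightarrow> bool" where
  "hamiltonian_vector_field H X \<longleftrightarrow>
     (\<forall>t\<in>{0..1}. \<forall>z\<in>disc. (H t has_derivative (\<lambda>v. - omega (X t z) v)) (at z within disc))"

text \<open>\<open>f t\<close> is the flow on \<^const>\<open>disc\<close>; its values for other arguments are irrelevant.\<close>

definition flow_of :: "(real \<Rightarrow> complex \<Rightarrow> complex) \<Rightarrow> (real \<Rightarrow> complex \<Rightarrow> complex) \<Rightarrow> bool" where
  "flow_of X f \<longleftrightarrow>
     (\<forall>z\<in>disc. f 0 z = z \<and>
        (\<forall>t\<in>{0..1}. f t z \<in> disc \<and>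
           ((\<lambda>s. f s z) has_vector_derivative X t (f t z)) (at t within {0..1})))"

definition hamiltonian_isotopy ::
  "(real \<Rightarrow> complex \<Rightarrow> real) \<Rightarrow> (real \<Rightarrow> complex \<Rightarrow> complex) \<Rightarrow> bool" where
  "hamiltonian_isotopy H f \<longleftrightarrow>
     normalized_hamiltonian H \<and> (\<exists>X. hamiltonian_vector_field H X \<and> flow_of X f)"

definition isotopy_to ::
  "(complex \<Rightarrow> complex) \<Rightarrow> (real \<Rightarrow> complex \<Rightarrow> real) \<Rightarrow> (real \<Rightarrow> complex \<Rightarrow> complex) \<Rightarrow> bool" where
  "isotopy_to \<phi> H f \<longleftrightarrow> hamiltonian_isotopy H f \<and> (\<forall>z\<in>disc. f 1 z = \<phi> z)"

text \<open>Self-maps of the disc are represented by extensional functions, so that each has a unique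
  representative.\<close>

definition Ham_c :: "(complex \<Rightarrow> complex) set" where
  "Ham_c = {\<phi> \<in> extensional disc. \<exists>H f. isotopy_to \<phi> H f}"

definition calabi_integral :: "(real \<Rightarrow> complex \<Rightarrow> real) \<Rightarrow> real" where
  "calabi_integral H =
     (LINT t:{0..1}|lborel. integral_2form disc (\<lambda>z u v. H t z * omega u v))"

definition X2 :: "(complex \<times> complex) set" where
  "X2 = {(z1, z2). z1 \<in> disc \<and> z2 \<in> disc \<and> z1 \<noteq> z2}"

text \<open>The value at the point \<open>x = (z1, z2)\<close> and the tangent vector \<open>v = (v1, v2)\<close>.\<close>

definition alpha :: "complex \<times> complex \<Rightarrow> complex \<times> complex \<Rightarrow> complex" where
  "alpha x v = 1 / (2 * complex_of_real pi) * ((fst v - snd v) / (fst x - snd x))"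

definition theta :: "complex \<times> complex \<Rightarrow> complex \<times> complex \<Rightarrow> real" where
  "theta x v = Im (alpha x v)"

definition rotation_integral :: "(real \<Rightarrow> complex \<Rightarrow> complex) \<Rightarrow> real" where
  "rotation_integral f =
     (LINT x:X2|lborel \<Otimes>\<^sub>M lborel. line_integral theta (\<lambda>t. (f t (fst x), f t (snd x))))"

text \<open>Both invariants are the common value over all isotopies ending at \<open>\<phi>\<close>. They are meaningful
  for \<open>\<phi> \<in> Ham_c\<close>.\<close>

definition Cal :: "(complex \<Rightarrow> complex) \<Rightarrow> real" where
  "Cal \<phi> = (THE c. \<exists>H f. isotopy_to \<phi> H f \<and> c = calabi_integral H)"

definition Phi :: "(complex \<Rightarrow> complex) \<Rightarrow> real" where
  "Phi \<phi> = (THE c. \<exists>H f. isotopy_to \<phi> H f \<and> c = rotation_integral f)"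

end

(*  Write X for the Hamiltonian vector field, a Lipschitz field which vanishes outside the disc.
    The line integral of theta along the orbit of (z1, z2) is the time integral of
    Im ((X z1 - X z2) / (z1 - z2)) / (2 pi), evaluated on the orbit. This integrand is bounded by the
    Lipschitz constant, so Fubini applies, and Liouville's theorem removes the flow at each time. By
    symmetry only the Cauchy transform of X is left, and since X is 2i times the d-bar derivative of H,
    the Cauchy-Pompeiu formula gives Im (int X z / (z - w) dz) = - 2 pi H w.

    Liouville's theorem is obtained without differentiating the flow in its initial point: the flow is
    the uniform limit of Euler polygons, each of whose steps of size s has Jacobian 1 + O(s^2) because X
    is divergence free. The Cauchy-Pompeiu formula is obtained from Tonelli's theorem and the scaling
    y = s z alone.

    That both invariants depend on the end point only is proved for the rotation number, and transferred
    to the Calabi invariant by the equality.  *)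

theory Submission
  imports Defs
begin

section \<open>Flows of Lipschitz fields\<close>

text \<open>The hypotheses give orbits one at a time: \<open>flow_of\<close> says nothing about how
  \<open>f t z\<close> depends on \<open>z\<close>, and the data live on the closed disc, with
  one-sided derivatives at its boundary. This is why the field and the Hamiltonian are extended to
  the plane by zero, the flow by the identity, and why Lipschitz estimates do the work of a smooth
  flow map. The Cauchy-Pompeiu formula comes down to the fundamental theorem of calculus because
  \<open>Im (X y / y)\<close> is the derivative of the Hamiltonian at \<open>y\<close> in the
  direction \<open>y\<close>, divided by the square of \<open>norm y\<close>; integration along rays
  suffices. The constant: \<open>theta\<close> carries 1 / (2 pi), the Cauchy transform contributes
  - 2 pi, and the exchange of the two points doubles it. Since \<open>Cal\<close> and
  \<open>Phi\<close> are defined by \<open>THE\<close>, well-definedness belongs to the proof. For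
  the rotation number it holds before integration: the winding of each pair depends on the time-one
  map only, since pairs on the boundary circle never move and every pair of distinct points can be
  carried to such a pair.\<close>

lemma gronwall_unit_interval:
  fixes u u' :: "real \<Rightarrow> 'a::real_inner"
  assumes der: "\<And>t. t \<in> {0..1} \<Longrightarrow> (u has_vector_derivative u' t) (at t within {0..1})"
    and le: "\<And>t. t \<in> {0..1} \<Longrightarrow> norm (u' t) \<le> L * norm (u t)"
    and t: "t \<in> {0..1}"
  shows "norm (u t) \<le> exp (L * t) * norm (u 0)" and "norm (u 0) \<le> exp (L * t) * norm (u t)"
proof -
  have cont: "continuous_on {0..t} u"
    using continuous_on_subset[OF continuous_on_vector_derivative[OF der]] t by auto
  have inner: "\<bar>u s \<bullet> u' s\<bar> \<le> L * (u s \<bullet> u s)" if "s \<in> {0..1}" for s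
  proof -
    have "\<bar>u s \<bullet> u' s\<bar> \<le> norm (u s) * norm (u' s)" by (rule Cauchy_Schwarz_ineq2)
    also have "\<dots> \<le> norm (u s) * (L * norm (u s))" using le[OF that] by (intro mult_left_mono) auto
    finally show ?thesis by (simp add: dot_square_norm power2_eq_square mult_ac)
  qed
  have D: "((\<lambda>s. (u s \<bullet> u s) * exp (c * s)) has_real_derivative (2 * (u s \<bullet> u' s) + c * (u s \<bullet> u s)) * exp (c * s)) (at s)"
    if "0 < s" "s < t" for s c
  proof -
    have "(u has_vector_derivative u' s) (at s)"
      using der[of s] that t at_within_interior[of s "{0..1}"] by (auto simp: interior_atLeastAtMost_real)
    then show ?thesis
      unfolding has_vector_derivative_def has_field_derivative_def
      by (auto intro!: derivative_eq_intros simp: algebra_simps inner_commute)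
  qed
  \<comment> \<open>The exponential weight turns the bound on \<open>u \<bullet> u'\<close> into
    monotonicity: with exponent \<open>- 2 * L * s\<close> the weighted square is nonincreasing,
    with \<open>2 * L * s\<close>, further down, nondecreasing. The second case is what later makes
    the flow injective.\<close>
  have "(u t \<bullet> u t) * exp (- (2 * L) * t) \<le> (u 0 \<bullet> u 0) * exp (- (2 * L) * 0)"
  proof (rule DERIV_nonpos_imp_decreasing_open[where f = "\<lambda>s. (u s \<bullet> u s) * exp (- (2 * L) * s)"])
    fix s assume s: "0 < s" "s < t"
    then have "(2 * (u s \<bullet> u' s) + - (2 * L) * (u s \<bullet> u s)) * exp (- (2 * L) * s) \<le> 0"
      using inner[of s] t by (intro mult_nonpos_nonneg) auto
    with D[OF s] show "\<exists>y. ((\<lambda>s. (u s \<bullet> u s) * exp (- (2 * L) * s)) has_real_derivative y) (at s) \<and> y \<le> 0"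
      by blast
  qed (use t cont in \<open>auto intro!: continuous_intros\<close>)
  then have "norm (u t) ^ 2 \<le> (exp (L * t) * norm (u 0)) ^ 2"
    by (simp add: dot_square_norm exp_minus power_mult_distrib field_simps flip: exp_double)
  then show "norm (u t) \<le> exp (L * t) * norm (u 0)"
    by (rule power2_le_imp_le) auto
  have "(u 0 \<bullet> u 0) * exp ((2 * L) * 0) \<le> (u t \<bullet> u t) * exp ((2 * L) * t)"
  proof (rule DERIV_nonneg_imp_increasing_open[where f = "\<lambda>s. (u s \<bullet> u s) * exp ((2 * L) * s)"])
    fix s assume s: "0 < s" "s < t"
    then have "(2 * (u s \<bullet> u' s) + (2 * L) * (u s \<bullet> u s)) * exp ((2 * L) * s) \<ge> 0"
      using inner[of s] t by (intro mult_nonneg_nonneg) auto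
    with D[OF s] show "\<exists>y. ((\<lambda>s. (u s \<bullet> u s) * exp ((2 * L) * s)) has_real_derivative y) (at s) \<and> y \<ge> 0"
      by blast
  qed (use t cont in \<open>auto intro!: continuous_intros\<close>)
  then have "norm (u 0) ^ 2 \<le> (exp (L * t) * norm (u t)) ^ 2"
    by (simp add: dot_square_norm power_mult_distrib field_simps flip: exp_double)
  then show "norm (u 0) \<le> exp (L * t) * norm (u t)"
    by (rule power2_le_imp_le) auto
qed

section \<open>Liouville's theorem\<close>

text \<open>Determinants and the change of variables formula live on \<open>real^2\<close>, so
  Lebesgue measure has to be carried over to \<open>complex\<close>. Agreement on boxes is
  enough.\<close>

lemma distr_lborel_complex_vec2:
  "distr (lborel :: (real^2) measure) borel (\<lambda>v. Complex (v$1) (v$2)) = lborel"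
proof -
  let ?J = "\<lambda>v::real^2. Complex (v$1) (v$2)"
  have cont: "continuous_on UNIV ?J"
    by (intro continuous_intros)
  have meas: "?J \<in> borel_measurable borel"
    by (rule borel_measurable_continuous_onI[OF cont])
  have "lborel = distr (lborel :: (real^2) measure) borel ?J"
  proof (rule lborel_eqI)
    fix l u :: complex
    assume le: "\<And>b. b \<in> Basis \<Longrightarrow> l \<bullet> b \<le> u \<bullet> b"
    have "?J -` box l u = box (\<chi> i. if i = 1 then Re l else Im l) (\<chi> i. if i = 1 then Re u else Im u)"
      by (auto simp: box_def Basis_complex_def Basis_vec_def inner_axis forall_2)
    moreover have "Re l \<le> Re u" using le[of 1] by (simp add: Basis_complex_def)
    moreover have "Im l \<le> Im u" using le[of \<i>] by (simp add: Basis_complex_def)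
    ultimately have "emeasure (distr (lborel :: (real^2) measure) borel ?J) (box l u) =
        ennreal ((Re u - Re l) * (Im u - Im l))"
      by (simp add: emeasure_distr meas emeasure_lborel_box_eq Basis_vec_def inner_axis
          forall_2 UNIV_2 axis_eq_axis)
    also have "(Re u - Re l) * (Im u - Im l) = (\<Prod>b\<in>Basis. (u - l) \<bullet> b)"
      by (simp add: Basis_complex_def)
    finally show "emeasure (distr (lborel :: (real^2) measure) borel ?J) (box l u) =
        ennreal (\<Prod>b\<in>Basis. (u - l) \<bullet> b)" .
  qed simp
  then show ?thesis by simp
qed

text \<open>\<open>T\<close> maps the preimage injectively into \<open>A\<close>, and the measure of
  the image is the integral of the absolute determinant, hence at least \<open>\<kappa>\<close>
  times the measure of the preimage. The estimate is phrased with preimages because these compose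
  along a chain of maps.\<close>

lemma emeasure_vimage_jacobian_vec2:
  fixes T :: "real^2 \<Rightarrow> real^2"
  assumes inj: "inj T" and der: "\<And>x. (T has_derivative T' x) (at x)"
    and det: "\<And>x. \<kappa> \<le> det (matrix (T' x))" and \<kappa>: "0 \<le> \<kappa>" and A: "A \<in> sets borel"
  shows "ennreal \<kappa> * emeasure lborel (T -` A) \<le> emeasure lborel A"
proof (cases "emeasure lborel A = \<infinity>")
  case False
  have contT: "continuous_on UNIV T"
    by (meson continuous_at_imp_continuous_on der has_derivative_continuous)
  have measT: "T \<in> borel_measurable borel"
    by (rule borel_measurable_continuous_onI[OF contT])
  have B: "T -` A \<in> sets borel"
    using measurable_sets[OF measT A] by simp
  have Almeas: "A \<in> lmeasurable"
    using A False by (auto simp: fmeasurable_def top.not_eq_extremum)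
  \<comment> \<open>Intersecting with balls makes the measures finite, so that real-valued integrals
    are available; continuity from below removes the cut afterwards.\<close>
  have fin: "ennreal \<kappa> * emeasure lborel (T -` A \<inter> cball 0 (real n)) \<le> emeasure lborel A" for n
  proof -
    let ?S = "T -` A \<inter> cball 0 (real n)"
    have Sb: "?S \<in> sets borel" using B by auto
    have Sl: "?S \<in> lmeasurable"
      by (metis Sb Int_commute borel_closed closed_cball fmeasurable_Int_fmeasurable
          lmeasurable_cball sets_completionI_sets sets_lborel B)
    have sub: "T ` ?S \<subseteq> A" by auto
    have dS: "(T has_derivative T' x) (at x within ?S)" for x
      using der has_derivative_at_withinI by blast
    have "T ` ?S \<in> sets lebesgue"
      by (rule differentiable_image_in_sets_lebesgue)
        (use Sl dS in \<open>auto simp: differentiable_on_def differentiable_def\<close>)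
    then have TS: "T ` ?S \<in> lmeasurable"
      using Almeas sub by (metis fmeasurableI2)
    have injS: "inj_on T ?S" using inj by (meson inj_on_subset subset_UNIV)
    have hi: "((\<lambda>x. \<bar>det (matrix (T' x))\<bar>) has_integral measure lebesgue (T ` ?S)) ?S"
      using has_measure_differentiable_image[of ?S T T'] Sl dS injS TS by auto
    have "((\<lambda>x. 1 :: real) has_integral measure lebesgue ?S) ?S"
      using Sl by (metis integrable_integral lmeasurable_iff_integrable_on lmeasure_integral)
    from has_integral_mult_right[OF this, of \<kappa>]
    have "((\<lambda>x. \<kappa>) has_integral \<kappa> * measure lebesgue ?S) ?S"
      by simp
    then have "\<kappa> * measure lebesgue ?S \<le> measure lebesgue (T ` ?S)"
      by (rule has_integral_le[OF _ hi]) (meson det abs_ge_self order_trans)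
    also have "\<dots> \<le> measure lebesgue A"
      using measure_mono_fmeasurable[OF sub _ Almeas] TS by auto
    finally have "\<kappa> * measure lborel ?S \<le> measure lborel A"
      using Sb A by simp
    moreover have "emeasure lborel ?S = ennreal (measure lborel ?S)"
      using emeasure_bounded_finite[of ?S] by (simp add: emeasure_eq_ennreal_measure bounded_Int)
    moreover have "emeasure lborel A = ennreal (measure lborel A)"
      using False by (simp add: emeasure_eq_ennreal_measure)
    ultimately show ?thesis
      using \<kappa> by (simp flip: ennreal_mult)
  qed
  have "(SUP n. emeasure lborel (T -` A \<inter> cball 0 (real n))) = emeasure lborel (\<Union>n. T -` A \<inter> cball 0 (real n))"
    by (rule SUP_emeasure_incseq) (use B in \<open>auto simp: incseq_def\<close>)
  also have "(\<Union>n. T -` A \<inter> cball 0 (real n)) = T -` A"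
    using real_arch_simple by auto
  finally have eq: "(SUP n. emeasure lborel (T -` A \<inter> cball 0 (real n))) = emeasure lborel (T -` A)" .
  show ?thesis
    unfolding eq[symmetric] by (subst SUP_mult_left_ennreal) (rule SUP_least, rule fin)
qed simp

lemma emeasure_vimage_jacobian_complex:
  fixes S :: "complex \<Rightarrow> complex"
  assumes inj: "inj S"
    and der: "\<And>z. \<exists>a b c d. (S has_derivative (\<lambda>v. Complex (a * Re v + b * Im v) (c * Re v + d * Im v))) (at z)
                 \<and> \<kappa> \<le> a * d - b * c"
    and \<kappa>: "0 \<le> \<kappa>" and A: "A \<in> sets borel"
  shows "ennreal \<kappa> * emeasure lborel (S -` A) \<le> emeasure lborel A"
proof -
  define J where "J = (\<lambda>v::real^2. Complex (v$1) (v$2))"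
  define K where "K = (\<lambda>z. vector [Re z, Im z] :: real^2)"
  have JK [simp]: "J (K z) = z" for z by (simp add: J_def K_def)
  have KJ [simp]: "K (J v) = v" for v by (simp add: J_def K_def vec_eq_iff forall_2)
  have linJ: "bounded_linear J"
    unfolding linear_conv_bounded_linear[symmetric]
    by (rule linearI) (auto simp: J_def complex_eq_iff)
  have linK: "bounded_linear K"
    unfolding linear_conv_bounded_linear[symmetric]
    by (rule linearI) (auto simp: K_def vec_eq_iff forall_2)
  have Jmeas [measurable]: "J \<in> borel_measurable borel"
    using linJ by (simp add: borel_measurable_continuous_onI linear_continuous_on)
  obtain a b c d where S': "\<And>z. (S has_derivative (\<lambda>v. Complex (a z * Re v + b z * Im v) (c z * Re v + d z * Im v))) (at z)"
     and det: "\<And>z. \<kappa> \<le> a z * d z - b z * c z"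
  proof -
    from der have "\<forall>z. \<exists>a b c d. (S has_derivative (\<lambda>v. Complex (a * Re v + b * Im v) (c * Re v + d * Im v))) (at z)
                 \<and> \<kappa> \<le> a * d - b * c" by blast
    then show ?thesis unfolding choice_iff using that by blast
  qed
  have Scont: "continuous_on UNIV S"
    by (meson continuous_at_imp_continuous_on S' has_derivative_continuous)
  then have Smeas: "S \<in> borel_measurable borel"
    by (rule borel_measurable_continuous_onI)
  define T where "T = (\<lambda>v. K (S (J v)))"
  define T' where "T' = (\<lambda>x v. K ((\<lambda>v. Complex (a (J x) * Re v + b (J x) * Im v) (c (J x) * Re v + d (J x) * Im v)) (J v)))"
  have Tder: "(T has_derivative T' x) (at x)" for x
    unfolding T_def T'_def
    by (intro bounded_linear.has_derivative[OF linK]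
        has_derivative_compose[OF bounded_linear.has_derivative[OF linJ has_derivative_ident] S'])
  have Tdet: "det (matrix (T' x)) = a (J x) * d (J x) - b (J x) * c (J x)" for x
    by (simp add: det_2 matrix_def T'_def J_def K_def axis_def)
  have "inj T" using inj KJ JK unfolding T_def inj_def by metis
  moreover have JA: "J -` A \<in> sets borel" using measurable_sets[OF Jmeas A] by simp
  ultimately have *: "ennreal \<kappa> * emeasure lborel (T -` (J -` A)) \<le> emeasure lborel (J -` A)"
    using emeasure_vimage_jacobian_vec2[OF _ Tder _ \<kappa>] det Tdet by metis
  have Jdist: "emeasure lborel B = emeasure lborel (J -` B)" if "B \<in> sets borel" for B
    using that by (subst distr_lborel_complex_vec2[symmetric]) (simp add: emeasure_distr J_def[symmetric])
  have "T -` (J -` A) = J -` (S -` A)" by (auto simp: T_def)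
  moreover have "S -` A \<in> sets borel" using measurable_sets[OF Smeas A] by simp
  ultimately show ?thesis using * Jdist A by simp
qed

text \<open>The difference quotients in direction \<open>v\<close> are bounded by
  \<open>L * norm v\<close>, hence so is their limit. It serves to bound the Jacobian entries of the
  field by its Lipschitz constant.\<close>

lemma norm_derivative_le_lipschitz:
  fixes f :: "'a::real_normed_vector \<Rightarrow> 'b::real_normed_vector"
  assumes der: "(f has_derivative D) (at z)" and lip: "\<And>x y. norm (f x - f y) \<le> L * norm (x - y)"
  shows "norm (D v) \<le> L * norm v"
proof -
  have "((\<lambda>s::real. f (z + s *\<^sub>R v)) has_derivative (\<lambda>s. D (s *\<^sub>R v))) (at 0)"
    by (rule has_derivative_compose[of "\<lambda>s. z + s *\<^sub>R v" "\<lambda>s. s *\<^sub>R v" 0 UNIV f D, simplified])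
       (auto intro!: derivative_eq_intros der)
  then have "((\<lambda>s::real. f (z + s *\<^sub>R v)) has_vector_derivative D v) (at 0)"
    using has_derivative_linear[OF der]
    by (simp add: has_vector_derivative_def linear_cmul)
  then have "((\<lambda>h. norm (f (z + h *\<^sub>R v) - f z - h *\<^sub>R D v) / \<bar>h\<bar>) \<longlongrightarrow> 0) (at 0)"
    by (simp add: has_vector_derivative_def has_derivative_at)
  from tendsto_add[OF tendsto_const this, of "L * norm v"]
  have lim: "((\<lambda>h. L * norm v + norm (f (z + h *\<^sub>R v) - f z - h *\<^sub>R D v) / \<bar>h\<bar>) \<longlongrightarrow> L * norm v) (at 0)"
    by simp
  have "norm (D v) \<le> L * norm v + norm (f (z + h *\<^sub>R v) - f z - h *\<^sub>R D v) / \<bar>h\<bar>" if "h \<noteq> 0" for h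
  proof -
    have "norm (h *\<^sub>R D v) \<le> norm (f (z + h *\<^sub>R v) - f z) + norm (f (z + h *\<^sub>R v) - f z - h *\<^sub>R D v)"
      using norm_triangle_sub[of "h *\<^sub>R D v" "f (z + h *\<^sub>R v) - f z"] by (simp add: norm_minus_commute)
    also have "\<dots> \<le> L * norm (h *\<^sub>R v) + norm (f (z + h *\<^sub>R v) - f z - h *\<^sub>R D v)"
      using lip[of "z + h *\<^sub>R v" z] by simp
    finally show ?thesis using that by (simp add: field_simps)
  qed
  then show ?thesis
    by (intro tendsto_lowerbound[OF lim]) (auto simp: eventually_at_filter)
qed

text \<open>The matrix with rows \<open>(a, b)\<close> and \<open>(c, - a)\<close> in
  \<open>Y_trace_zero\<close> says that the field is divergence free. The map \<open>F\<close> is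
  described by its orbits alone; its regularity in the initial point is derived from the Lipschitz
  bound on \<open>Y\<close>.\<close>

locale disc_flow =
  fixes Y F :: "real \<Rightarrow> complex \<Rightarrow> complex" and L :: real
  assumes L0: "0 \<le> L"
    and Y_lipschitz: "\<lbrakk>s \<in> {0..1}; t \<in> {0..1}\<rbrakk> \<Longrightarrow> norm (Y s z - Y t w) \<le> L * (\<bar>s - t\<bar> + norm (z - w))"
    and Y_outside: "\<lbrakk>t \<in> {0..1}; 1 \<le> norm z\<rbrakk> \<Longrightarrow> Y t z = 0"
    and Y_trace_zero: "t \<in> {0..1} \<Longrightarrow>
      \<exists>a b c. (Y t has_derivative (\<lambda>v. Complex (a * Re v + b * Im v) (c * Re v - a * Im v))) (at z)"
    and F_0 [simp]: "F 0 z = z"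
    and F_deriv: "t \<in> {0..1} \<Longrightarrow> ((\<lambda>s. F s z) has_vector_derivative Y t (F t z)) (at t within {0..1})"
    and F_disc: "\<lbrakk>t \<in> {0..1}; z \<in> disc\<rbrakk> \<Longrightarrow> F t z \<in> disc"
begin

lemma Y_lipschitz_space: "t \<in> {0..1} \<Longrightarrow> norm (Y t z - Y t w) \<le> L * norm (z - w)"
  using Y_lipschitz[of t t z w] by simp

lemma Y_bound: assumes "t \<in> {0..1}" shows "norm (Y t z) \<le> 3 * L"
proof (cases "norm z \<le> 1")
  case True
  \<comment> \<open>The point 2 lies outside the disc, where the field vanishes, and its distance
    from \<open>z\<close> is at most 3.\<close>
  have "norm (Y t z) \<le> L * norm (z - 2)"
    using Y_lipschitz_space[OF assms, of z 2] Y_outside[OF assms, of 2] by simp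
  also have "\<dots> \<le> L * 3"
    using norm_triangle_ineq4[of z 2] True L0 by (intro mult_left_mono) auto
  finally show ?thesis by simp
qed (use Y_outside[OF assms, of z] L0 in auto)

lemma F_gronwall:
  assumes "t \<in> {0..1}"
  shows F_lipschitz_space: "norm (F t z - F t w) \<le> exp (L * t) * norm (z - w)"
    and F_expand: "norm (z - w) \<le> exp (L * t) * norm (F t z - F t w)"
  using gronwall_unit_interval[of "\<lambda>t. F t z - F t w" "\<lambda>t. Y t (F t z) - Y t (F t w)" L t]
    assms Y_lipschitz_space has_vector_derivative_diff[OF F_deriv F_deriv] by auto

lemma F_outside:
  assumes "t \<in> {0..1}" "1 \<le> norm z"
  shows "F t z = z"
proof -
  \<comment> \<open>The constant curve \<open>z\<close> is an orbit too, because
    \<open>Y t z = 0\<close>, and both orbits have the same initial point.\<close>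
  have "norm (F t z - z) \<le> exp (L * t) * norm (F 0 z - z)"
    by (rule gronwall_unit_interval[of "\<lambda>t. F t z - z" "\<lambda>t. Y t (F t z) - Y t z"])
      (use assms Y_outside Y_lipschitz_space[of _ "F _ z" z] in \<open>auto intro!: derivative_eq_intros F_deriv\<close>)
  then show ?thesis by simp
qed

lemma F_disc_iff: "t \<in> {0..1} \<Longrightarrow> F t z \<in> disc \<longleftrightarrow> z \<in> disc"
  using F_disc[of t z] F_outside[of t z] by (cases "norm z \<le> 1") auto

lemma F_inj: "t \<in> {0..1} \<Longrightarrow> F t z = F t w \<longleftrightarrow> z = w"
  using F_expand[of t z w] by auto

lemma F_lipschitz_time:
  assumes "s \<in> {0..1}" "t \<in> {0..1}" shows "norm (F s z - F t z) \<le> 3 * L * \<bar>s - t\<bar>"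
proof -
  have "onorm (\<lambda>h. h *\<^sub>R Y r (F r z)) \<le> 3 * L" if "r \<in> {0..1}" for r
    using Y_bound[OF that, of "F r z"]
    by (intro onorm_bound) (auto simp: mult.commute[of "\<bar>_\<bar>"] mult_right_mono L0)
  then have "norm (F s z - F t z) \<le> 3 * L * norm (s - t)"
    by (intro differentiable_bound[of "{0..1}" "\<lambda>s. F s z" "\<lambda>r h. h *\<^sub>R Y r (F r z)"])
      (use assms F_deriv in \<open>auto simp: has_vector_derivative_def\<close>)
  then show ?thesis by simp
qed

text \<open>Along an orbit the velocity changes at a rate of at most \<open>L * (1 + 3 * L)\<close>:
  \<open>L\<close> from the explicit time dependence, and \<open>L\<close> times the speed bound
  \<open>3 * L\<close> from the motion. An Euler step is therefore exact up to order
  \<open>h\<^sup>2\<close>.\<close>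

lemma F_local_error:
  assumes "t \<in> {0..1}" "t + h \<in> {0..1}" "0 \<le> h"
  shows "norm (F (t + h) z - F t z - h *\<^sub>R Y t (F t z)) \<le> L * (1 + 3 * L) * h\<^sup>2"
proof -
  have "norm (F (t + h) z - F t z - (t + h - t) *\<^sub>R Y t (F t z)) \<le> norm (t + h - t) * (L * (1 + 3 * L) * h)"
  proof (rule vector_differentiable_bound_linearization[of "{t..t+h}"])
    fix r assume r: "r \<in> {t..t+h}"
    then show "((\<lambda>s. F s z) has_vector_derivative Y r (F r z)) (at r within {t..t+h})"
      using assms by (intro has_vector_derivative_within_subset[OF F_deriv]) auto
    have "norm (Y r (F r z) - Y t (F t z)) \<le> L * (\<bar>r - t\<bar> + norm (F r z - F t z))"
      using r assms by (intro Y_lipschitz) auto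
    also have "\<dots> \<le> L * (\<bar>r - t\<bar> + 3 * L * \<bar>r - t\<bar>)"
      using r assms L0 by (intro mult_left_mono add_left_mono F_lipschitz_time) auto
    also have "\<dots> = L * (1 + 3 * L) * \<bar>r - t\<bar>" by (simp add: algebra_simps)
    also have "\<dots> \<le> L * (1 + 3 * L) * h"
      using r L0 by (intro mult_left_mono) auto
    finally show "norm (Y r (F r z) - Y t (F t z)) \<le> L * (1 + 3 * L) * h" .
  qed (use assms in \<open>auto simp: closed_segment_eq_real_ivl\<close>)
  then show ?thesis using assms by (simp add: power2_eq_square mult_ac)
qed

section \<open>Euler polygons: uniform convergence and almost preservation of measure\<close>

primrec euler :: "real \<Rightarrow> nat \<Rightarrow> complex \<Rightarrow> complex" where
  "euler h 0 z = z"
| "euler h (Suc k) z = euler h k z + h *\<^sub>R Y (real k * h) (euler h k z)"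

text \<open>A step multiplies the accumulated error by at most \<open>1 + L * h\<close> and adds a
  local error \<open>C\<close>. Each of the \<open>k\<close> local errors is amplified by at most
  \<open>(1 + L * h) ^ k\<close>, which gives the coarse bound stated here.\<close>

lemma euler_error:
  assumes "0 \<le> h" "real k * h \<le> 1"
  shows "norm (euler h k z - F (real k * h) z) \<le> real k * (L * (1 + 3 * L) * h\<^sup>2) * (1 + L * h) ^ k"
  using assms(2)
proof (induction k)
  case (Suc k)
  define e where "e = euler h k z"
  define f where "f = F (real k * h) z"
  define C where "C = L * (1 + 3 * L) * h\<^sup>2"
  have t: "real k * h \<in> {0..1}" "real k * h + h \<in> {0..1}"
    using Suc.prems assms(1) by (auto simp: algebra_simps)
  then have IH: "norm (e - f) \<le> real k * C * (1 + L * h) ^ k"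
    using Suc.IH by (simp add: e_def f_def C_def)
  have C0: "0 \<le> C" using L0 by (simp add: C_def)
  have pow1: "1 \<le> (1 + L * h) ^ Suc k" using L0 assms(1) by (intro one_le_power) auto
  have "euler h (Suc k) z - F (real (Suc k) * h) z =
     (e - f) + h *\<^sub>R (Y (real k * h) e - Y (real k * h) f)
      - (F (real k * h + h) z - f - h *\<^sub>R Y (real k * h) f)"
    by (simp add: e_def f_def algebra_simps)
  also have "norm \<dots> \<le> (norm (e - f) + norm (h *\<^sub>R (Y (real k * h) e - Y (real k * h) f)))
      + norm (F (real k * h + h) z - f - h *\<^sub>R Y (real k * h) f)"
    by (intro norm_triangle_le_diff add_mono norm_triangle_ineq order_refl)
  also have "\<dots> \<le> (norm (e - f) + h * (L * norm (e - f))) + C"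
    unfolding C_def f_def using Y_lipschitz_space[OF t(1)] assms(1) 
    by (intro add_mono F_local_error t) (auto simp: mult_left_mono)
  also have "\<dots> = (1 + L * h) * norm (e - f) + C" by (simp add: algebra_simps)
  also have "\<dots> \<le> (1 + L * h) * (real k * C * (1 + L * h) ^ k) + C * (1 + L * h) ^ Suc k"
    using IH L0 assms(1) C0 pow1 mult_left_mono[OF pow1 C0] by (intro add_mono mult_left_mono) auto
  also have "\<dots> = real (Suc k) * C * (1 + L * h) ^ Suc k"
    by (simp add: algebra_simps)
  finally show ?case by (simp add: C_def)
qed simp

lemma euler_error_uniform:
  assumes "0 \<le> h" "real k * h \<le> 1"
  shows "norm (euler h k z - F (real k * h) z) \<le> L * (1 + 3 * L) * exp L * h"
proof -
  have "(1 + L * h) ^ k \<le> exp (L * h) ^ k"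
    using L0 assms(1) by (intro power_mono) (auto simp: exp_ge_add_one_self)
  also have "\<dots> = exp (L * (real k * h))" by (simp add: exp_of_nat_mult[symmetric] mult_ac)
  also have "\<dots> \<le> exp L" using L0 assms(2) by (simp add: mult_left_le)
  finally have 1: "(1 + L * h) ^ k \<le> exp L" .
  have "norm (euler h k z - F (real k * h) z) \<le> real k * (L * (1 + 3 * L) * h\<^sup>2) * (1 + L * h) ^ k"
    by (rule euler_error[OF assms])
  also have "\<dots> \<le> real k * (L * (1 + 3 * L) * h\<^sup>2) * exp L"
    using 1 L0 by (intro mult_left_mono) auto
  also have "\<dots> = (real k * h) * (L * (1 + 3 * L) * exp L * h)"
    by (simp add: power2_eq_square)
  also have "\<dots> \<le> 1 * (L * (1 + 3 * L) * exp L * h)"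
    using L0 assms by (intro mult_right_mono) auto
  finally show ?thesis by simp
qed

text \<open>As the trace vanishes, the first order terms cancel: the Jacobian is
  \<open>1 - h\<^sup>2 * (a * a + b * c)\<close>, and all entries are at most \<open>L\<close> in
  absolute value. The restriction \<open>L * h \<le> 1/2\<close> makes the perturbation
  \<open>h Y\<close> of the identity a contraction, hence the step injective, and keeps the lower
  bound nonnegative.\<close>

lemma emeasure_vimage_euler_step:
  assumes t: "t \<in> {0..1}" and h: "0 \<le> h" "L * h \<le> 1/2" and A: "A \<in> sets borel"
  shows "ennreal (1 - 2 * L\<^sup>2 * h\<^sup>2) * emeasure lborel ((\<lambda>z. z + h *\<^sub>R Y t z) -` A) \<le> emeasure lborel A"
proof (rule emeasure_vimage_jacobian_complex[OF _ _ _ A])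
  show "inj (\<lambda>z. z + h *\<^sub>R Y t z)"
  proof (rule injI)
    fix z w assume "z + h *\<^sub>R Y t z = w + h *\<^sub>R Y t w"
    then have "z - w = h *\<^sub>R (Y t w - Y t z)" by (simp add: algebra_simps)
    then have "norm (z - w) = h * norm (Y t w - Y t z)" using h by simp
    also have "\<dots> \<le> h * (L * norm (w - z))" using h by (intro mult_left_mono Y_lipschitz_space t) auto
    also have "\<dots> \<le> 1/2 * norm (z - w)" using h mult_right_mono[OF h(2), of "norm (z - w)"]
      by (simp add: norm_minus_commute mult_ac)
    finally show "z = w" by simp
  qed
  have "(L * h)\<^sup>2 \<le> (1/2)\<^sup>2" using h L0 by (intro power_mono) auto
  then show "0 \<le> 1 - 2 * L\<^sup>2 * h\<^sup>2" by (simp add: power_mult_distrib power_divide)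
  fix z
  obtain a b c where D: "(Y t has_derivative (\<lambda>v. Complex (a * Re v + b * Im v) (c * Re v - a * Im v))) (at z)"
    using Y_trace_zero[OF t] by blast
  have n: "norm (Complex (a * Re v + b * Im v) (c * Re v - a * Im v)) \<le> L * norm v" for v
    by (rule norm_derivative_le_lipschitz[OF D Y_lipschitz_space[OF t]])
  have "\<bar>a\<bar> \<le> L" "\<bar>c\<bar> \<le> L"
    using n[of 1] abs_Re_le_cmod[of "Complex a c"] abs_Im_le_cmod[of "Complex a c"] by auto
  moreover have "\<bar>b\<bar> \<le> L"
    using n[of \<i>] abs_Re_le_cmod[of "Complex b (-a)"] by auto
  ultimately have "\<bar>a\<bar> * \<bar>a\<bar> \<le> L * L" "\<bar>b\<bar> * \<bar>c\<bar> \<le> L * L" using L0 by (intro mult_mono; simp)+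
  then have "a * a + b * c \<le> 2 * L\<^sup>2" by (simp add: power2_eq_square abs_mult[symmetric])
  then have "h\<^sup>2 * (a * a + b * c) \<le> h\<^sup>2 * (2 * L\<^sup>2)" by (rule mult_left_mono) simp
  then have "1 - 2 * L\<^sup>2 * h\<^sup>2 \<le> (1 + h * a) * (1 - h * a) - (h * b) * (h * c)"
    by (simp add: algebra_simps power2_eq_square)
  moreover have "((\<lambda>z. z + h *\<^sub>R Y t z) has_derivative
     (\<lambda>v. Complex ((1 + h * a) * Re v + (h * b) * Im v) ((h * c) * Re v + (1 - h * a) * Im v))) (at z)"
    by (rule derivative_eq_intros D refl)+ (simp add: fun_eq_iff complex_eq_iff algebra_simps)
  ultimately show "\<exists>a b c d. ((\<lambda>z. z + h *\<^sub>R Y t z) has_derivative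
      (\<lambda>v. Complex (a * Re v + b * Im v) (c * Re v + d * Im v))) (at z) \<and> 1 - 2 * L\<^sup>2 * h\<^sup>2 \<le> a * d - b * c"
    by blast
qed

lemma Y_continuous: "t \<in> {0..1} \<Longrightarrow> continuous_on UNIV (Y t)"
  by (rule lipschitz_on_continuous_on[of L]) (auto intro!: lipschitz_onI Y_lipschitz_space simp: dist_norm L0)

lemma F_continuous: "t \<in> {0..1} \<Longrightarrow> continuous_on UNIV (F t)"
  by (rule lipschitz_on_continuous_on[of "exp (L * t)"])
    (auto intro!: lipschitz_onI F_lipschitz_space simp: dist_norm L0)

lemma F_measurable: "t \<in> {0..1} \<Longrightarrow> F t \<in> borel_measurable borel"
  by (rule borel_measurable_continuous_onI[OF F_continuous])

text \<open>The last step is undone first: the preimage of \<open>A\<close> under it is again a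
  Borel set, to which the induction hypothesis applies. Hence the induction is over all
  \<open>A\<close>.\<close>

lemma euler_vimage:
  assumes "0 \<le> h" "L * h \<le> 1/2" "A \<in> sets borel" "real k * h \<le> 1"
  shows "ennreal ((1 - 2 * L\<^sup>2 * h\<^sup>2) ^ k) * emeasure lborel (euler h k -` A) \<le> emeasure lborel A"
  using assms(3,4)
proof (induction k arbitrary: A)
  case 0
  have "euler h 0 -` A = A" by auto
  then show ?case by simp
next
  case (Suc k)
  let ?S = "\<lambda>z. z + h *\<^sub>R Y (real k * h) z"
  have t: "real k * h \<in> {0..1}" using Suc.prems assms(1) by (auto simp: algebra_simps)
  have "?S \<in> borel_measurable borel"
    by (intro borel_measurable_continuous_onI continuous_intros Y_continuous t)
  then have S: "?S -` A \<in> sets borel" using Suc.prems measurable_sets[of ?S borel borel A] by simp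
  have eq: "euler h (Suc k) -` A = euler h k -` (?S -` A)" by auto
  have pos: "0 \<le> 1 - 2 * L\<^sup>2 * h\<^sup>2"
  proof -
    have "(L * h)\<^sup>2 \<le> (1/2)\<^sup>2" using assms L0 by (intro power_mono) auto
    then show ?thesis by (simp add: power_mult_distrib power_divide)
  qed
  have "ennreal ((1 - 2 * L\<^sup>2 * h\<^sup>2) ^ Suc k) * emeasure lborel (euler h (Suc k) -` A)
    = ennreal (1 - 2 * L\<^sup>2 * h\<^sup>2) * (ennreal ((1 - 2 * L\<^sup>2 * h\<^sup>2) ^ k) * emeasure lborel (euler h k -` (?S -` A)))"
    using pos by (simp add: eq ennreal_mult mult_ac del: euler.simps)
  also have "\<dots> \<le> ennreal (1 - 2 * L\<^sup>2 * h\<^sup>2) * emeasure lborel (?S -` A)"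
    using Suc.IH[OF S] t by (intro mult_left_mono) auto
  also have "\<dots> \<le> emeasure lborel A"
    by (rule emeasure_vimage_euler_step[OF t assms(1,2) Suc.prems(1)])
  finally show ?case .
qed

text \<open>The room \<open>\<epsilon>\<close> between \<open>K\<close> and the complement of
  \<open>A\<close> absorbs the distance between the flow and a fine Euler polygon: whatever the flow
  sends into \<open>K\<close>, the polygon sends into \<open>A\<close>. The \<open>n\<close> steps
  lose a factor \<open>1 - 2 * L\<^sup>2 * t\<^sup>2 / n\<close> in total, which tends to 1.\<close>

lemma emeasure_vimage_flow_compact_open:
  assumes t: "t \<in> {0..1}" and K: "compact K" and A: "open A" and sub: "K \<subseteq> A"
  shows "emeasure lborel (F t -` K) \<le> emeasure lborel A"
proof -
  obtain \<epsilon> where \<epsilon>: "\<epsilon> > 0" "(\<Union>x\<in>K. ball x \<epsilon>) \<subseteq> A"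
    using compact_subset_open_imp_ball_epsilon_subset[OF K A sub] .
  \<comment> \<open>With this step size the vertex number \<open>n\<close> of the polygon is at time
    \<open>t\<close> exactly. The value \<open>h 0 = 0\<close> does no harm, since only large
    \<open>n\<close> count.\<close>
  define h where "h n = t / real n" for n
  have h: "h \<longlonglongrightarrow> 0" unfolding h_def by real_asymp
  have ev1: "\<forall>\<^sub>F n in sequentially. L * h n < 1/2"
    by (rule order_tendstoD(2)[OF tendsto_mult_right_zero[OF h]]) auto
  have ev2: "\<forall>\<^sub>F n in sequentially. L * (1 + 3 * L) * exp L * h n < \<epsilon>"
    by (rule order_tendstoD(2)[OF tendsto_mult_right_zero[OF h]]) (use \<epsilon> in auto)
  have ev: "\<forall>\<^sub>F n in sequentially. ennreal (1 - 2 * L\<^sup>2 * t\<^sup>2 / real n) * emeasure lborel (F t -` K) \<le> emeasure lborel A"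
    using ev1 ev2 eventually_gt_at_top[of 0]
  proof eventually_elim
    case (elim n)
    have nh: "real n * h n = t" using elim by (simp add: h_def)
    have h0: "0 \<le> h n" using t by (simp add: h_def)
    have "F t -` K \<subseteq> euler (h n) n -` A"
    proof
      fix z assume "z \<in> F t -` K"
      moreover have "norm (euler (h n) n z - F t z) < \<epsilon>"
        using euler_error_uniform[OF h0, of n z] nh t elim by auto
      ultimately show "z \<in> euler (h n) n -` A" using \<epsilon>(2)
        by (fastforce simp: dist_norm norm_minus_commute)
    qed
    moreover have "euler (h n) k -` A \<in> sets borel" if "k \<le> n" for k
    proof -
      have "continuous_on UNIV (euler (h n) k)" using that
      proof (induction k)
        case (Suc k)
        have "real k * h n \<le> real n * h n" using h0 Suc.prems by (intro mult_right_mono) auto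
        then have "real k * h n \<in> {0..1}" using h0 t nh by auto
        from Y_continuous[OF this] Suc show ?case
          by (auto intro!: continuous_intros continuous_on_compose2[of UNIV "Y (real k * h n)"])
      qed simp
      then show ?thesis using A by (intro borel_open) (auto simp: continuous_on_open_vimage)
    qed
    ultimately have le: "emeasure lborel (F t -` K) \<le> emeasure lborel (euler (h n) n -` A)"
      by (intro emeasure_mono) auto
    have "(2 * L\<^sup>2 * (h n)\<^sup>2) \<le> 1"
      using power_mono[OF less_imp_le[OF elim(1)], of 2] L0 h0 by (simp add: power_mult_distrib power_divide)
    then have "1 + real n * (- (2 * L\<^sup>2 * (h n)\<^sup>2)) \<le> (1 + - (2 * L\<^sup>2 * (h n)\<^sup>2)) ^ n"
      by (intro Bernoulli_inequality) auto
    moreover have "real n * (- (2 * L\<^sup>2 * (h n)\<^sup>2)) = - (2 * L\<^sup>2 * t\<^sup>2 / real n)"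
      using elim by (simp add: h_def power2_eq_square)
    ultimately have "1 - 2 * L\<^sup>2 * t\<^sup>2 / real n \<le> (1 - 2 * L\<^sup>2 * (h n)\<^sup>2) ^ n" by simp
    then have "ennreal (1 - 2 * L\<^sup>2 * t\<^sup>2 / real n) * emeasure lborel (F t -` K)
      \<le> ennreal ((1 - 2 * L\<^sup>2 * (h n)\<^sup>2) ^ n) * emeasure lborel (euler (h n) n -` A)"
      by (intro mult_mono le ennreal_leI) auto
    also have "\<dots> \<le> emeasure lborel A"
      by (rule euler_vimage) (use elim A h0 nh t in auto)
    finally show ?case .
  qed
  have "(\<lambda>n. 1 - 2 * L\<^sup>2 * t\<^sup>2 / real n) \<longlonglongrightarrow> 1" by real_asymp
  then have "(\<lambda>n. ennreal (1 - 2 * L\<^sup>2 * t\<^sup>2 / real n) * emeasure lborel (F t -` K)) \<longlonglongrightarrow> ennreal 1 * emeasure lborel (F t -` K)"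
    by (intro tendsto_mult_ennreal tendsto_ennrealI tendsto_const) auto
  from tendsto_le[OF _ tendsto_const this ev] show ?thesis by simp
qed

text \<open>Open sets are exhausted by compact subsets, and Borel sets are approximated from outside
  by open ones.\<close>

lemma emeasure_vimage_flow_le:
  assumes t: "t \<in> {0..1}" and A: "A \<in> sets borel"
  shows "emeasure lborel (F t -` A) \<le> emeasure lborel A"
proof -
  have op: "emeasure lborel (F t -` U) \<le> emeasure lborel U" if U: "open U" for U
  proof -
    obtain C where C: "\<And>n. compact (C n)" "\<And>n. C n \<subseteq> U" "\<And>n. C n \<subseteq> interior (C (Suc n))"
        "\<Union>(range C) = U"
      by (rule open_Union_compact_subsets[OF U], rule that, assumption+)
    have inc: "incseq C"
      by (rule incseq_SucI) (meson C(3) interior_subset order_trans)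
    have meas: "F t -` C n \<in> sets borel" for n
      using measurable_sets[OF F_measurable[OF t], of "C n"] C(1)[of n] by (simp add: borel_compact)
    have "F t -` U = (\<Union>n. F t -` C n)" using C(4) by auto
    also have "emeasure lborel \<dots> = (SUP n. emeasure lborel (F t -` C n))"
      by (rule SUP_emeasure_incseq[symmetric]) (use meas inc in \<open>force simp: incseq_def\<close>)+
    also have "\<dots> \<le> emeasure lborel U"
      by (rule SUP_least) (rule emeasure_vimage_flow_compact_open[OF t C(1) U C(2)])
    finally show ?thesis .
  qed
  show ?thesis
  proof (rule ennreal_le_epsilon)
    fix e :: real assume "0 < e"
    then obtain U where U: "open U" "A \<subseteq> U" "emeasure lborel (U - A) < e"
      using outer_regular_lborel[OF A] by metis
    have "emeasure lborel (F t -` A) \<le> emeasure lborel (F t -` U)"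
      by (rule emeasure_mono) (use U F_measurable[OF t] measurable_sets[OF F_measurable[OF t], of U] in auto)
    also have "\<dots> \<le> emeasure lborel U" by (rule op[OF U(1)])
    also have "\<dots> = emeasure lborel A + emeasure lborel (U - A)"
      using U A by (subst plus_emeasure) (auto simp: Un_absorb1)
    also have "\<dots> \<le> emeasure lborel A + ennreal e" using U by (intro add_left_mono) auto
    finally show "emeasure lborel (F t -` A) \<le> emeasure lborel A + ennreal e" .
  qed
qed

text \<open>The inequality becomes an equality by complementation: it holds for
  \<open>A \<inter> disc\<close> and for \<open>disc - A\<close>, and the preimages of these two
  sets again make up the disc, whose measure is finite. Off the disc the flow is the
  identity.\<close>

theorem liouville:
  assumes t: "t \<in> {0..1}"
  shows "distr lborel borel (F t) = lborel"
proof (rule measure_eqI)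
  fix A assume "A \<in> sets (distr lborel borel (F t))"
  then have A: "A \<in> sets borel" by simp
  note meas = measurable_sets[OF F_measurable[OF t], simplified]
  have fin: "emeasure lborel disc < \<infinity>" by (rule emeasure_lborel_cball_finite)
  have vd: "F t -` disc = disc" using F_disc_iff[OF t] by auto
  have "emeasure lborel (F t -` (A \<inter> disc)) = emeasure lborel (A \<inter> disc)"
  proof (rule antisym)
    show "emeasure lborel (F t -` (A \<inter> disc)) \<le> emeasure lborel (A \<inter> disc)"
      using A by (intro emeasure_vimage_flow_le t) auto
    have "emeasure lborel (A \<inter> disc) + emeasure lborel (disc - A) = emeasure lborel disc"
      using A by (subst plus_emeasure) (auto intro!: arg_cong[where f="emeasure lborel"])
    also have "\<dots> = emeasure lborel (F t -` (A \<inter> disc)) + emeasure lborel (F t -` (disc - A))"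
      using A vd by (subst plus_emeasure) (auto intro!: meas arg_cong[where f="emeasure lborel"])
    also have "\<dots> \<le> emeasure lborel (F t -` (A \<inter> disc)) + emeasure lborel (disc - A)"
      using A by (intro add_left_mono emeasure_vimage_flow_le t) auto
    finally have "emeasure lborel (A \<inter> disc) + emeasure lborel (disc - A)
      \<le> emeasure lborel (F t -` (A \<inter> disc)) + emeasure lborel (disc - A)" .
    moreover have "emeasure lborel (disc - A) < \<infinity>"
      by (intro emeasure_bounded_finite bounded_subset[OF bounded_cball Diff_subset])
    ultimately show "emeasure lborel (A \<inter> disc) \<le> emeasure lborel (F t -` (A \<inter> disc))"
      by (metis add_mono_thms_linordered_semiring(1) ennreal_add_left_cancel_le add.commute infinity_ennreal_def order.irrefl)
  qed
  moreover have "F t -` (A - disc) = A - disc"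
    using F_disc_iff[OF t] F_outside[OF t] by auto
  ultimately have "emeasure lborel (F t -` (A \<inter> disc)) + emeasure lborel (F t -` (A - disc))
      = emeasure lborel (A \<inter> disc) + emeasure lborel (A - disc)" by simp
  also have "emeasure lborel (F t -` (A \<inter> disc)) + emeasure lborel (F t -` (A - disc)) = emeasure lborel (F t -` A)"
    using A by (subst plus_emeasure) (auto intro!: meas arg_cong[where f="emeasure lborel"])
  also have "emeasure lborel (A \<inter> disc) + emeasure lborel (A - disc) = emeasure lborel A"
    using A by (subst plus_emeasure) (auto intro!: arg_cong[where f="emeasure lborel"])
  finally show "emeasure (distr lborel borel (F t)) A = emeasure lborel A"
    using A F_measurable[OF t] by (simp add: emeasure_distr)
qed simp

end

section \<open>The Cauchy-Pompeiu formula\<close>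

lemma nn_integral_scaleR_complex:
  fixes f :: "complex \<Rightarrow> ennreal"
  assumes [measurable]: "f \<in> borel_measurable borel" and "s \<noteq> 0"
  shows "(\<integral>\<^sup>+y. f y \<partial>lborel) = ennreal (s\<^sup>2) * (\<integral>\<^sup>+z. f (s *\<^sub>R z) \<partial>lborel)"
proof -
  have "(\<integral>\<^sup>+y. f y \<partial>lborel) =
      (\<integral>\<^sup>+y. f y \<partial>density (distr lborel borel (\<lambda>x. 0 + s *\<^sub>R x)) (\<lambda>_. ennreal (\<bar>s\<bar> ^ DIM(complex))))"
    using lborel_affine[OF assms(2), of "0::complex"] by simp
  also have "\<dots> = (\<integral>\<^sup>+y. ennreal (\<bar>s\<bar> ^ 2) * f (s *\<^sub>R y) \<partial>lborel)"
    by (simp add: nn_integral_density nn_integral_distr)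
  finally show ?thesis by (simp add: nn_integral_cmult)
qed

lemma nn_integral_inverse_cube:
  assumes "0 < a"
  shows "(\<integral>\<^sup>+s. ennreal (2 / s ^ 3) * indicator {a..} s \<partial>lborel) = ennreal (1 / a\<^sup>2)"
proof -
  have "(\<integral>\<^sup>+s. ennreal (2 / s ^ 3) * indicator {a..} s \<partial>lborel) = ennreal (0 - (- 1 / a\<^sup>2))"
  proof (rule nn_integral_FTC_atLeast[where F="\<lambda>s. - 1 / s\<^sup>2"])
    show "((\<lambda>s::real. - 1 / s\<^sup>2) \<longlongrightarrow> 0) at_top" by real_asymp
    show "((\<lambda>s. - 1 / s\<^sup>2) has_real_derivative 2 / s ^ 3) (at s)" if "a \<le> s" for s
      using that assms by (auto intro!: derivative_eq_intros simp: field_simps eval_nat_numeral)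
  qed (use assms in auto)
  then show ?thesis by simp
qed

text \<open>The factor \<open>2 / s\<close> makes the push-forward under \<open>(z, s) \<mapsto> s z\<close> have density
  \<open>1 / \<bar>y\<bar>\<^sup>2\<close>, the weight of the Cauchy kernel, because \<open>2 / s\<^sup>3\<close> has integral \<open>1 / \<bar>y\<bar>\<^sup>2\<close>
  over \<open>s \<ge> \<bar>y\<bar>\<close>.\<close>

definition polar_density :: "complex \<times> real \<Rightarrow> real" where
  "polar_density = (\<lambda>(z, s). if norm z \<le> 1 \<and> 0 < s then 2 / s else 0)"

lemma polar_density_nonneg: "0 \<le> polar_density p"
  by (auto simp: polar_density_def indicator_def split: prod.splits)

lemma polar_density_measurable [measurable]: "polar_density \<in> borel_measurable (lborel \<Otimes>\<^sub>M lborel)"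
  unfolding polar_density_def by measurable

text \<open>For fixed \<open>s\<close> the substitution \<open>y = s z\<close> has Jacobian
  \<open>s\<^sup>2\<close>, so the weight \<open>2 / s\<close> on the unit disc becomes
  \<open>2 / s ^ 3\<close> on the disc of radius \<open>s\<close>. After the exchange of the
  integrals, \<open>s\<close> runs over \<open>s \<ge> norm y\<close> for fixed
  \<open>y\<close>.\<close>

lemma nn_integral_radial:
  fixes f :: "complex \<Rightarrow> ennreal"
  assumes f [measurable]: "f \<in> borel_measurable borel"
  shows "(\<integral>\<^sup>+p. ennreal (polar_density p) * f (snd p *\<^sub>R fst p) \<partial>(lborel \<Otimes>\<^sub>M lborel)) =
         (\<integral>\<^sup>+y. ennreal (1 / (norm y)\<^sup>2) * f y \<partial>lborel)"
proof -
  let ?k = "\<lambda>s y. if 0 < s \<and> norm y \<le> s then ennreal (2 / s ^ 3) else 0"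
  have "(\<integral>\<^sup>+p. ennreal (polar_density p) * f (snd p *\<^sub>R fst p) \<partial>(lborel \<Otimes>\<^sub>M lborel)) =
    (\<integral>\<^sup>+s. (\<integral>\<^sup>+z. ennreal (polar_density (z, s)) * f (s *\<^sub>R z) \<partial>lborel) \<partial>lborel)"
    by (subst lborel_pair.nn_integral_snd[symmetric]) auto
  also have "\<dots> = (\<integral>\<^sup>+s. (\<integral>\<^sup>+y. ?k s y * f y \<partial>lborel) \<partial>lborel)"
  proof (rule nn_integral_cong)
    fix s :: real
    show "(\<integral>\<^sup>+z. ennreal (polar_density (z, s)) * f (s *\<^sub>R z) \<partial>lborel) =
       (\<integral>\<^sup>+y. ?k s y * f y \<partial>lborel)"
    proof (cases "0 < s")
      case True
      have "(\<integral>\<^sup>+y. ?k s y * f y \<partial>lborel)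
         = ennreal (s\<^sup>2) * (\<integral>\<^sup>+z. ?k s (s *\<^sub>R z) * f (s *\<^sub>R z) \<partial>lborel)"
        by (rule nn_integral_scaleR_complex) (use True in auto)
      also have "\<dots> = (\<integral>\<^sup>+z. ennreal (s\<^sup>2) * (?k s (s *\<^sub>R z) * f (s *\<^sub>R z)) \<partial>lborel)"
        by (rule nn_integral_cmult[symmetric]) simp
      also have "\<dots> = (\<integral>\<^sup>+z. ennreal (polar_density (z, s)) * f (s *\<^sub>R z) \<partial>lborel)"
      proof (rule nn_integral_cong)
        fix z :: complex
        have "s\<^sup>2 * (2 / s ^ 3) = 2 / s" using True by (simp add: field_simps eval_nat_numeral)
        then have "ennreal (s\<^sup>2) * ennreal (2 / s ^ 3) = ennreal (2 / s)"
          by (metis ennreal_mult' zero_le_power2)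
        moreover have "norm (s *\<^sub>R z) \<le> s \<longleftrightarrow> norm z \<le> 1"
          using True by simp
        ultimately show "ennreal (s\<^sup>2) * (?k s (s *\<^sub>R z) * f (s *\<^sub>R z))
          = ennreal (polar_density (z, s)) * f (s *\<^sub>R z)"
          using True by (simp add: polar_density_def indicator_def mult.assoc[symmetric])
      qed
      finally show ?thesis by simp
    qed (simp add: polar_density_def)
  qed
  also have "\<dots> = (\<integral>\<^sup>+y. (\<integral>\<^sup>+s. ?k s y * f y \<partial>lborel) \<partial>lborel)"
    by (rule lborel_pair.Fubini') measurable
  also have "\<dots> = (\<integral>\<^sup>+y. ennreal (1 / (norm y)\<^sup>2) * f y \<partial>lborel)"
  proof (rule nn_integral_cong_AE)
    \<comment> \<open>The origin has to be left out: the inner integral may diverge there, whereas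
      \<open>1 / 0\<close> is 0.\<close>
    have "AE y in lborel. y \<noteq> (0::complex)" by (rule AE_lborel_singleton)
    then show "AE y in lborel. (\<integral>\<^sup>+s. ?k s y * f y \<partial>lborel)
       = ennreal (1 / (norm y)\<^sup>2) * f y"
    proof eventually_elim
      case (elim y)
      have "(\<integral>\<^sup>+s. ?k s y * f y \<partial>lborel)
        = (\<integral>\<^sup>+s. (ennreal (2 / s ^ 3) * indicator {norm y..} s) * f y \<partial>lborel)"
        using elim by (intro nn_integral_cong) (auto simp: indicator_def intro: less_le_trans[of 0 "norm y"])
      also have "\<dots> = ennreal (1 / (norm y)\<^sup>2) * f y"
        using nn_integral_inverse_cube[of "norm y"] elim by (subst nn_integral_multc) auto
      finally show ?case .
    qed
  qed
  finally show ?thesis .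
qed

text \<open>As an equality of measures the radial formula also transports Bochner integrals of
  integrands that change sign.\<close>

lemma distr_polar_density:
  "distr (density (lborel \<Otimes>\<^sub>M lborel) (\<lambda>p. ennreal (polar_density p))) borel (\<lambda>p. snd p *\<^sub>R fst p)
    = density lborel (\<lambda>y. ennreal (1 / (norm y)\<^sup>2))" (is "?A = ?B")
proof (rule measure_eqI)
  fix A assume "A \<in> sets ?A"
  then have A [measurable]: "A \<in> sets borel" by simp
  have "emeasure ?A A = (\<integral>\<^sup>+p. ennreal (polar_density p) * indicator A (snd p *\<^sub>R fst p) \<partial>(lborel \<Otimes>\<^sub>M lborel))"
    by (subst nn_integral_indicator[symmetric], simp, subst nn_integral_distr) (simp_all add: nn_integral_density)
  also have "\<dots> = emeasure ?B A"
    by (subst nn_integral_radial) (simp_all add: emeasure_density)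
  finally show "emeasure ?A A = emeasure ?B A" .
qed simp

lemma omega_bound: "\<bar>omega u v\<bar> \<le> norm u * norm v"
proof -
  have "omega u v = Im (cnj u * v)" by (simp add: omega_eq_det)
  then show ?thesis using abs_Im_le_cmod[of "cnj u * v"] by (simp add: norm_mult)
qed

text \<open>For a field \<open>X\<close> with \<open>dg = - omega X\<close>, this identifies the
  imaginary part of the Cauchy kernel \<open>X y / y\<close> with the derivative of \<open>g\<close>
  at \<open>y\<close> in the direction \<open>y\<close>, over the square of
  \<open>norm y\<close>.\<close>

lemma Im_div_eq_omega: "Im (u / y) = - omega u y / (norm y)\<^sup>2"
  by (simp add: Im_divide cmod_power2 omega_eq_det algebra_simps)

context
  fixes g :: "complex \<Rightarrow> real" and X :: "complex \<Rightarrow> complex" and M R :: real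
  assumes der: "\<And>y. (g has_derivative (\<lambda>v. - omega (X y) v)) (at y)"
    and cont: "continuous_on UNIV X"
    and X0: "\<And>y. R \<le> norm y \<Longrightarrow> X y = 0" and g0: "\<And>y. R \<le> norm y \<Longrightarrow> g y = 0"
    and M: "\<And>y. norm (X y) \<le> M" and R: "0 < R"
begin

lemma X_measurable: "X \<in> borel_measurable borel"
  by (rule borel_measurable_continuous_onI[OF cont])

text \<open>On the ray through \<open>z\<close> the integrand is at most
  \<open>(2 / s) * M * s * norm z = 2 * M * norm z\<close>, and it vanishes beyond
  \<open>s = R / norm z\<close>. Each ray thus contributes at most \<open>2 * M * R\<close>, and the
  rays are indexed by a disc of area \<open>pi\<close>. The bound licenses Fubini for the signed
  integrand.\<close>

lemma nn_integral_cauchy_kernel_radial: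
  "(\<integral>\<^sup>+p. ennreal (polar_density p) * ennreal \<bar>omega (X (snd p *\<^sub>R fst p)) (snd p *\<^sub>R fst p)\<bar> \<partial>(lborel \<Otimes>\<^sub>M lborel))
    \<le> ennreal (2 * M * R * pi)"
proof -
  have M0: "0 \<le> M" using M[of 0] norm_ge_zero order_trans by blast
  note X_measurable [measurable]
  have [measurable]: "(\<lambda>y. omega (X y) y) \<in> borel_measurable borel"
    unfolding omega_eq_det by measurable
  have "(\<integral>\<^sup>+p. ennreal (polar_density p) * ennreal \<bar>omega (X (snd p *\<^sub>R fst p)) (snd p *\<^sub>R fst p)\<bar> \<partial>(lborel \<Otimes>\<^sub>M lborel))
     = (\<integral>\<^sup>+z. (\<integral>\<^sup>+s. ennreal (polar_density (z, s)) * ennreal \<bar>omega (X (s *\<^sub>R z)) (s *\<^sub>R z)\<bar> \<partial>lborel) \<partial>lborel)"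
    by (subst lborel.nn_integral_fst[symmetric]) auto
  also have "\<dots> \<le> (\<integral>\<^sup>+z. ennreal (2 * M * R) * indicator disc z \<partial>(lborel :: complex measure))"
  proof (rule nn_integral_mono_AE)
    have "AE z in lborel. z \<noteq> (0::complex)" by (rule AE_lborel_singleton)
    then show "AE z in lborel. (\<integral>\<^sup>+s. ennreal (polar_density (z, s)) * ennreal \<bar>omega (X (s *\<^sub>R z)) (s *\<^sub>R z)\<bar> \<partial>lborel)
       \<le> ennreal (2 * M * R) * indicator disc z"
    proof eventually_elim
      case (elim z)
      have "(\<integral>\<^sup>+s. ennreal (polar_density (z, s)) * ennreal \<bar>omega (X (s *\<^sub>R z)) (s *\<^sub>R z)\<bar> \<partial>lborel)
        \<le> (\<integral>\<^sup>+s. ennreal (2 * M * norm z) * indicator disc z * indicator {0..R / norm z} s \<partial>lborel)"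
      proof (rule nn_integral_mono)
        fix s :: real
        show "ennreal (polar_density (z, s)) * ennreal \<bar>omega (X (s *\<^sub>R z)) (s *\<^sub>R z)\<bar>
          \<le> ennreal (2 * M * norm z) * indicator disc z * indicator {0..R / norm z} s"
        proof (cases "0 < s \<and> z \<in> disc \<and> s \<le> R / norm z")
          case True
          have "\<bar>omega (X (s *\<^sub>R z)) (s *\<^sub>R z)\<bar> \<le> norm (X (s *\<^sub>R z)) * norm (s *\<^sub>R z)"
            by (rule omega_bound)
          also have "\<dots> \<le> M * (s * norm z)" using True M M0 by (intro mult_mono) auto
          finally have "polar_density (z, s) * \<bar>omega (X (s *\<^sub>R z)) (s *\<^sub>R z)\<bar> \<le> (2 / s) * (M * (s * norm z))"
            unfolding polar_density_def using True by (intro mult_mono) auto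
          also have "\<dots> = 2 * M * norm z" using True by simp
          finally show ?thesis using True polar_density_nonneg[of "(z, s)"]
            by (simp add: ennreal_mult'[symmetric] ennreal_leI)
        next
          case False
          moreover have "omega (X (s *\<^sub>R z)) (s *\<^sub>R z) = 0" if "0 < s" "R / norm z < s"
          proof -
            have "R \<le> norm (s *\<^sub>R z)" using that elim by (simp add: field_simps)
            then show ?thesis by (simp add: X0 omega_def)
          qed
          ultimately show ?thesis by (auto simp: polar_density_def indicator_def)
        qed
      qed
      also have "\<dots> = ennreal (2 * M * norm z) * indicator disc z * ennreal (R / norm z)"
        using R elim by (simp add: nn_integral_cmult_indicator)
      also have "\<dots> = ennreal (2 * M * R) * indicator disc z"
        using R M0 elim by (simp add: ennreal_mult'[symmetric] mult_ac indicator_def)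
      finally show ?case .
    qed
  qed
  also have "\<dots> = ennreal (2 * M * R) * ennreal pi"
    by (simp add: nn_integral_cmult_indicator emeasure_cball unit_ball_vol_2)
  also have "\<dots> = ennreal (2 * M * R * pi)" using M0 R by (simp add: ennreal_mult)
  finally show ?thesis .
qed

lemma nn_integral_cauchy_kernel:
  "(\<integral>\<^sup>+y. ennreal \<bar>Im (X y / y)\<bar> \<partial>lborel) \<le> ennreal (2 * M * R * pi)"
proof -
  note X_measurable [measurable]
  have [measurable]: "(\<lambda>y. omega (X y) y) \<in> borel_measurable borel"
    unfolding omega_eq_det by measurable
  have "(\<integral>\<^sup>+y. ennreal \<bar>Im (X y / y)\<bar> \<partial>lborel) = (\<integral>\<^sup>+y. ennreal (1 / (norm y)\<^sup>2) * ennreal \<bar>omega (X y) y\<bar> \<partial>lborel)"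
    by (intro nn_integral_cong) (simp add: Im_div_eq_omega ennreal_mult'[symmetric])
  also have "\<dots> \<le> ennreal (2 * M * R * pi)"
    by (subst nn_integral_radial[symmetric]) (use nn_integral_cauchy_kernel_radial in auto)
  finally show ?thesis .
qed

text \<open>The factor \<open>s\<close> in \<open>omega (X (s *\<^sub>R z)) (s *\<^sub>R z)\<close>
  cancels the \<open>1 / s\<close> of the density. What remains is twice the derivative of
  \<open>s \<mapsto> g (s *\<^sub>R z)\<close>, integrated from the centre to a point where
  \<open>g\<close> vanishes.\<close>

lemma cauchy_pompeiu_radial:
  assumes z: "z \<noteq> 0"
  shows "(LINT s|lborel. polar_density (z, s) * - omega (X (s *\<^sub>R z)) (s *\<^sub>R z)) = - 2 * g 0 * indicator disc z"
proof -
  define b where "b = R / norm z"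
  define \<phi> where "\<phi> s = - omega (X (s *\<^sub>R z)) z" for s
  have b: "0 < b" using R z by (simp add: b_def)
  have \<phi>0: "\<phi> s = 0" if "b < s" for s
  proof -
    have "R \<le> norm (s *\<^sub>R z)" using that z R b order_less_trans[OF b that] by (simp add: b_def field_simps)
    then show ?thesis by (simp add: \<phi>_def X0 omega_def)
  qed
  have c: "continuous_on UNIV \<phi>"
    unfolding \<phi>_def omega_eq_det
    by (intro continuous_intros continuous_on_compose2[OF cont]) auto
  have "(LINT s|lborel. indicator {0..b} s *\<^sub>R \<phi> s) = g (b *\<^sub>R z) - g (0 *\<^sub>R z)"
  proof (rule integral_FTC_Icc)
    show "continuous_on {0..b} \<phi>" using c continuous_on_subset by blast
    fix s :: real
    have "((\<lambda>s. g (s *\<^sub>R z)) has_derivative (\<lambda>h. - omega (X (s *\<^sub>R z)) (h *\<^sub>R z))) (at s within {0..b})"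
      by (rule has_derivative_compose[OF _ der]) (auto intro!: derivative_eq_intros)
    then show "((\<lambda>s. g (s *\<^sub>R z)) has_vector_derivative \<phi> s) (at s within {0..b})"
      unfolding has_vector_derivative_def \<phi>_def by (simp add: omega_eq_det algebra_simps)
  qed (use b in auto)
  also have "\<dots> = - g 0" using g0[of "b *\<^sub>R z"] z R by (simp add: b_def)
  finally have I: "(LINT s|lborel. indicator {0..b} s *\<^sub>R \<phi> s) = - g 0" .
  have "(LINT s|lborel. polar_density (z, s) * - omega (X (s *\<^sub>R z)) (s *\<^sub>R z))
     = (LINT s|lborel. (2 * indicator disc z) * (indicator {0..b} s *\<^sub>R \<phi> s))"
  proof (rule integral_cong_AE)
    have [measurable]: "\<phi> \<in> borel_measurable borel" by (rule borel_measurable_continuous_onI[OF c])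
    show "(\<lambda>s. (2 * indicator disc z) * (indicator {0..b} s *\<^sub>R \<phi> s)) \<in> borel_measurable lborel" by measurable
    show "(\<lambda>s. polar_density (z, s) * - omega (X (s *\<^sub>R z)) (s *\<^sub>R z)) \<in> borel_measurable lborel"
      unfolding omega_eq_det using X_measurable by measurable
    have "AE s in lborel. s \<noteq> (0::real)" by (rule AE_lborel_singleton)
    then show "AE s in lborel. polar_density (z, s) * - omega (X (s *\<^sub>R z)) (s *\<^sub>R z) =
       (2 * indicator disc z) * (indicator {0..b} s *\<^sub>R \<phi> s)"
    proof eventually_elim
      case (elim s)
      have om: "- omega (X (s *\<^sub>R z)) (s *\<^sub>R z) = s * \<phi> s"
        by (simp add: \<phi>_def omega_eq_det algebra_simps)
      show ?case
        unfolding om polar_density_def using elim \<phi>0[of s] by (auto simp: indicator_def)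
    qed
  qed
  also have "\<dots> = (2 * indicator disc z) * (- g 0)" by (simp only: integral_mult_right_zero I)
  finally show ?thesis by simp
qed

text \<open>In the coordinates \<open>(z, s)\<close> the planar integral splits into rays, each with
  \<open>z\<close> in the unit disc contributing \<open>- 2 * g 0\<close>; the area
  \<open>pi\<close> of that disc supplies the other factor.\<close>

theorem cauchy_pompeiu: "(LINT y|lborel. Im (X y / y)) = - 2 * pi * g 0"
proof -
  note X_measurable [measurable]
  have [measurable]: "(\<lambda>y. omega (X y) y) \<in> borel_measurable borel"
    unfolding omega_eq_det by measurable
  define G where "G p = polar_density p * - omega (X (snd p *\<^sub>R fst p)) (snd p *\<^sub>R fst p)" for p
  have Gm: "G \<in> borel_measurable (lborel \<Otimes>\<^sub>M lborel)" unfolding G_def by measurable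
  have "(\<integral>\<^sup>+p. ennreal (norm (G p)) \<partial>(lborel \<Otimes>\<^sub>M lborel)) =
   (\<integral>\<^sup>+p. ennreal (polar_density p) * ennreal \<bar>omega (X (snd p *\<^sub>R fst p)) (snd p *\<^sub>R fst p)\<bar> \<partial>(lborel \<Otimes>\<^sub>M lborel))"
    by (intro nn_integral_cong) (simp add: G_def abs_mult polar_density_nonneg ennreal_mult'[symmetric])
  also have "\<dots> < \<infinity>" using nn_integral_cauchy_kernel_radial by (rule le_less_trans) simp
  finally have Gint: "integrable (lborel \<Otimes>\<^sub>M lborel) G"
    using Gm by (intro integrableI_bounded) auto
  have "(LINT y|lborel. Im (X y / y)) = (LINT y|lborel. (1 / (norm y)\<^sup>2) *\<^sub>R - omega (X y) y)"
    by (intro Bochner_Integration.integral_cong) (simp_all add: Im_div_eq_omega)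
  also have "\<dots> = (LINT y|density lborel (\<lambda>y. ennreal (1 / (norm y)\<^sup>2)). - omega (X y) y)"
    by (rule integral_density[symmetric]) auto
  also have "\<dots> = (LINT p|density (lborel \<Otimes>\<^sub>M lborel) (\<lambda>p. ennreal (polar_density p)).
      - omega (X (snd p *\<^sub>R fst p)) (snd p *\<^sub>R fst p))"
    unfolding distr_polar_density[symmetric] by (rule integral_distr) auto
  also have "\<dots> = (LINT p|(lborel \<Otimes>\<^sub>M lborel). G p)"
    unfolding G_def by (subst integral_density) (auto simp: polar_density_nonneg)
  also have "\<dots> = (LINT z|lborel. (LINT s|lborel. G (z, s)))"
    by (rule lborel_pair.integral_fst'[symmetric, OF Gint])
  also have "\<dots> = (LINT z|lborel. - 2 * g 0 * indicator disc z)"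
  proof (rule integral_cong_AE)
    show "(\<lambda>z. (LINT s|lborel. G (z, s))) \<in> borel_measurable lborel"
      using Gm by measurable
    have "AE z in lborel. z \<noteq> (0::complex)" by (rule AE_lborel_singleton)
    then show "AE z in lborel. (LINT s|lborel. G (z, s)) = - 2 * g 0 * indicator disc z"
      by eventually_elim (simp add: G_def cauchy_pompeiu_radial[simplified])
  qed (intro borel_measurable_times borel_measurable_const borel_measurable_indicator, auto)
  also have "\<dots> = - 2 * g 0 * pi"
    by (simp add: content_cball unit_ball_vol_2)
  finally show ?thesis by simp
qed

end

section \<open>Regularity of Hamiltonian isotopies\<close>

lemma Ck_on_has_derivative:
  assumes "\<And>k. Ck_on k g U" "x \<in> U"
  shows "(g has_derivative frechet_derivative g (at x)) (at x)"
  using assms(1)[of "Suc 0"] assms(2) by (simp add: frechet_derivative_works)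

lemma Ck_on_frechet_derivative:
  assumes "\<And>k. Ck_on k g U"
  shows "Ck_on k (\<lambda>x. frechet_derivative g (at x) v) U"
  using assms[of "Suc k"] by simp

text \<open>\<open>Ck_on\<close> controls one direction at a time. The derivatives along basis
  vectors are bounded on the compact set, their bounds add up to a bound for the operator norm, and
  convexity admits the mean value inequality.\<close>

lemma Ck_on_lipschitz:
  assumes g: "\<And>k. Ck_on k g U" and K: "compact K" "convex K" "K \<subseteq> U"
  obtains L where "0 \<le> L" "\<And>x y. \<lbrakk>x \<in> K; y \<in> K\<rbrakk> \<Longrightarrow> norm (g x - g y) \<le> L * norm (x - y)"
proof -
  have "\<exists>B. \<forall>x\<in>K. norm (frechet_derivative g (at x) b) \<le> B" for b
  proof -
    have "continuous_on K (\<lambda>x. frechet_derivative g (at x) b)"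
      using Ck_on_frechet_derivative[OF g, of 0 b] K(3) continuous_on_subset by auto
    from compact_imp_bounded[OF compact_continuous_image[OF this K(1)]] show ?thesis
      by (auto simp: bounded_iff)
  qed
  then obtain B where B: "\<And>b x. x \<in> K \<Longrightarrow> norm (frechet_derivative g (at x) b) \<le> B b" by metis
  define L where "L = (\<Sum>b\<in>Basis. \<bar>B b\<bar>)"
  have der: "(g has_derivative frechet_derivative g (at x)) (at x within K)" if "x \<in> K" for x
    using Ck_on_has_derivative[OF g] that K(3) has_derivative_at_withinI by blast
  have on: "onorm (frechet_derivative g (at x)) \<le> L" if "x \<in> K" for x
  proof -
    have "onorm (frechet_derivative g (at x)) \<le> (\<Sum>b\<in>Basis. norm (frechet_derivative g (at x) b))"
      by (rule onorm_componentwise[OF has_derivative_bounded_linear[OF der[OF that]]])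
    also have "\<dots> \<le> L" unfolding L_def using B[OF that] by (intro sum_mono) (meson abs_ge_self order_trans)
    finally show ?thesis .
  qed
  show thesis
  proof (rule that[of L])
    show "norm (g x - g y) \<le> L * norm (x - y)" if "x \<in> K" "y \<in> K" for x y
      by (rule differentiable_bound[OF K(2) der on that])
  qed (simp add: L_def sum_nonneg)
qed

section \<open>Symmetry of mixed second derivatives\<close>

lemma second_difference_mean_value:
  fixes g :: "'a::euclidean_space \<Rightarrow> real"
  assumes g: "\<And>k. Ck_on k g U" and s: "0 < s"
    and seg: "\<And>a b. \<lbrakk>0 \<le> a; a \<le> s; 0 \<le> b; b \<le> s\<rbrakk> \<Longrightarrow> p + a *\<^sub>R u + b *\<^sub>R v \<in> U"
  obtains a b where "0 < a" "a < s" "0 < b" "b < s"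
    "g (p + s *\<^sub>R u + s *\<^sub>R v) - g (p + s *\<^sub>R u) - g (p + s *\<^sub>R v) + g p =
      s\<^sup>2 * frechet_derivative (\<lambda>x. frechet_derivative g (at x) u) (at (p + a *\<^sub>R u + b *\<^sub>R v)) v"
proof -
  let ?D = "\<lambda>x. frechet_derivative g (at x)"
  let ?E = "\<lambda>x. frechet_derivative (\<lambda>x. ?D x u) (at x)"
  have line: "((\<lambda>a. \<phi> (c + a *\<^sub>R w)) has_real_derivative \<phi>' w) (at a)"
    if "(\<phi> has_derivative \<phi>') (at (c + a *\<^sub>R w))" for \<phi> :: "'a \<Rightarrow> real" and \<phi>' c w a
  proof -
    have "((\<lambda>a. \<phi> (c + a *\<^sub>R w)) has_derivative (\<lambda>h. \<phi>' (h *\<^sub>R w))) (at a)"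
      by (rule has_derivative_compose[of "\<lambda>a. c + a *\<^sub>R w" "\<lambda>h. h *\<^sub>R w" a UNIV \<phi> \<phi>'])
        (auto intro!: derivative_eq_intros that)
    then show ?thesis
      using linear_cmul[OF has_derivative_linear[OF that]]
      by (simp add: has_field_derivative_def mult_commute_abs)
  qed
  \<comment> \<open>The mean value theorem is applied along \<open>u\<close> to the increment in
    direction \<open>s *\<^sub>R v\<close>, and then along \<open>v\<close> to the derivative in
    direction \<open>u\<close>.\<close>
  have "\<exists>a>0. a < s \<and> (g (p + s *\<^sub>R v + s *\<^sub>R u) - g (p + s *\<^sub>R u)) - (g (p + s *\<^sub>R v + 0 *\<^sub>R u) - g (p + 0 *\<^sub>R u))
      = (s - 0) * (?D (p + s *\<^sub>R v + a *\<^sub>R u) u - ?D (p + a *\<^sub>R u) u)"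
  proof (rule MVT2[OF s, of "\<lambda>a. g (p + s *\<^sub>R v + a *\<^sub>R u) - g (p + a *\<^sub>R u)"])
    fix a assume "0 \<le> a" "a \<le> s"
    then have "p + s *\<^sub>R v + a *\<^sub>R u \<in> U" "p + a *\<^sub>R u \<in> U"
      using seg[of a s] seg[of a 0] s by (auto simp: algebra_simps)
    then show "((\<lambda>a. g (p + s *\<^sub>R v + a *\<^sub>R u) - g (p + a *\<^sub>R u)) has_real_derivative
        ?D (p + s *\<^sub>R v + a *\<^sub>R u) u - ?D (p + a *\<^sub>R u) u) (at a)"
      by (intro DERIV_diff line Ck_on_has_derivative[OF g])
  qed
  then obtain a where a: "0 < a" "a < s" and 1: "(g (p + s *\<^sub>R v + s *\<^sub>R u) - g (p + s *\<^sub>R u)) - (g (p + s *\<^sub>R v) - g p)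
      = s * (?D (p + s *\<^sub>R v + a *\<^sub>R u) u - ?D (p + a *\<^sub>R u) u)" by auto
  have "\<exists>b>0. b < s \<and> ?D (p + a *\<^sub>R u + s *\<^sub>R v) u - ?D (p + a *\<^sub>R u + 0 *\<^sub>R v) u = (s - 0) * ?E (p + a *\<^sub>R u + b *\<^sub>R v) v"
  proof (rule MVT2[OF s])
    fix b assume "0 \<le> b" "b \<le> s"
    then have "p + a *\<^sub>R u + b *\<^sub>R v \<in> U" using seg[of a b] a by auto
    then show "((\<lambda>b. ?D (p + a *\<^sub>R u + b *\<^sub>R v) u) has_real_derivative ?E (p + a *\<^sub>R u + b *\<^sub>R v) v) (at b)"
      by (intro line[of "\<lambda>x. ?D x u"] Ck_on_has_derivative[OF Ck_on_frechet_derivative[OF g]])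
  qed
  then obtain b where b: "0 < b" "b < s" and 2: "?D (p + a *\<^sub>R u + s *\<^sub>R v) u - ?D (p + a *\<^sub>R u) u = s * ?E (p + a *\<^sub>R u + b *\<^sub>R v) v"
    by auto
  show thesis
  proof (rule that[OF a b])
    show "g (p + s *\<^sub>R u + s *\<^sub>R v) - g (p + s *\<^sub>R u) - g (p + s *\<^sub>R v) + g p = s\<^sup>2 * ?E (p + a *\<^sub>R u + b *\<^sub>R v) v"
      using 1 2 by (simp add: algebra_simps power2_eq_square)
  qed
qed

text \<open>The second difference over a small parallelogram is symmetric in \<open>u\<close> and
  \<open>v\<close>, and it equals \<open>s\<^sup>2\<close> times either mixed derivative at some
  point near \<open>p\<close>. Continuity then forces the two to agree at \<open>p\<close>. This
  symmetry is what makes a Hamiltonian field divergence free.\<close>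

lemma symmetric_second_derivative:
  fixes g :: "'a::euclidean_space \<Rightarrow> real"
  assumes g: "\<And>k. Ck_on k g U" and U: "open U" "p \<in> U"
  shows "frechet_derivative (\<lambda>x. frechet_derivative g (at x) u) (at p) v =
         frechet_derivative (\<lambda>x. frechet_derivative g (at x) v) (at p) u"
proof (rule ccontr)
  define A where "A u v x = frechet_derivative (\<lambda>x. frechet_derivative g (at x) u) (at x) v" for u v x
  assume "\<not> ?thesis"
  then have ne: "A u v p \<noteq> A v u p" by (simp add: A_def)
  define e where "e = \<bar>A u v p - A v u p\<bar> / 2"
  have e: "0 < e" using ne by (simp add: e_def)
  have cont: "isCont (A u v) p" for u v
    using Ck_on_frechet_derivative[OF Ck_on_frechet_derivative[OF g], of 0 u v] U
    by (simp add: A_def[abs_def] continuous_on_eq_continuous_at)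
  obtain d1 where d1: "d1 > 0" "\<And>x. dist x p < d1 \<Longrightarrow> dist (A u v x) (A u v p) < e"
    using cont[of u v] e unfolding continuous_at_eps_delta by metis
  obtain d2 where d2: "d2 > 0" "\<And>x. dist x p < d2 \<Longrightarrow> dist (A v u x) (A v u p) < e"
    using cont[of v u] e unfolding continuous_at_eps_delta by metis
  obtain d3 where d3: "d3 > 0" "ball p d3 \<subseteq> U" using U open_contains_ball by metis
  define d where "d = min d1 (min d2 d3)"
  \<comment> \<open>The summand 1 keeps the denominator positive when \<open>u\<close> and
    \<open>v\<close> vanish; the factor 2 keeps the parallelogram strictly inside the ball of radius
    \<open>d\<close>.\<close>
  define s where "s = d / (2 * (norm u + norm v + 1))"
  have d: "d > 0" using d1 d2 d3 by (simp add: d_def)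
  have n: "norm u + norm v + 1 > 0" using norm_ge_zero[of u] norm_ge_zero[of v] by linarith
  have s: "s > 0" using d n by (simp add: s_def)
  have near: "dist (p + a *\<^sub>R u + b *\<^sub>R v) p < d" "dist (p + b *\<^sub>R v + a *\<^sub>R u) p < d"
    if "0 \<le> a" "a \<le> s" "0 \<le> b" "b \<le> s" for a b
  proof -
    have "norm (a *\<^sub>R u + b *\<^sub>R v) \<le> a * norm u + b * norm v"
      using norm_triangle_ineq[of "a *\<^sub>R u" "b *\<^sub>R v"] that by simp
    also have "\<dots> \<le> s * norm u + s * norm v" using that by (intro add_mono mult_right_mono) auto
    also have "\<dots> \<le> s * (norm u + norm v + 1)" using s by (simp add: algebra_simps)
    also have "\<dots> = d / 2" using n by (simp only: s_def times_divide_eq_left) (simp add: divide_simps)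
    also have "\<dots> < d" using d by simp
    finally show "dist (p + a *\<^sub>R u + b *\<^sub>R v) p < d" "dist (p + b *\<^sub>R v + a *\<^sub>R u) p < d"
      by (simp_all add: dist_norm add.assoc add.commute[of "b *\<^sub>R v"])
  qed
  have inU: "x \<in> U" if "dist x p < d" for x
    using that d3 by (auto simp: d_def dist_commute subset_iff)
  let ?\<Delta> = "g (p + s *\<^sub>R u + s *\<^sub>R v) - g (p + s *\<^sub>R u) - g (p + s *\<^sub>R v) + g p"
  obtain a b where 1: "0 < a" "a < s" "0 < b" "b < s" "?\<Delta> = s\<^sup>2 * A u v (p + a *\<^sub>R u + b *\<^sub>R v)"
    by (rule second_difference_mean_value[OF g s, of p u v]) (use near inU in \<open>auto simp: A_def\<close>)
  obtain a' b' where 2: "0 < a'" "a' < s" "0 < b'" "b' < s"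
      "g (p + s *\<^sub>R v + s *\<^sub>R u) - g (p + s *\<^sub>R v) - g (p + s *\<^sub>R u) + g p = s\<^sup>2 * A v u (p + a' *\<^sub>R v + b' *\<^sub>R u)"
    by (rule second_difference_mean_value[OF g s, of p v u]) (use near inU in \<open>auto simp: A_def\<close>)
  have "p + s *\<^sub>R v + s *\<^sub>R u = p + s *\<^sub>R u + s *\<^sub>R v" by (simp add: algebra_simps)
  with 2(5) have "?\<Delta> = s\<^sup>2 * A v u (p + a' *\<^sub>R v + b' *\<^sub>R u)" by simp
  with 1(5) s have "A u v (p + a *\<^sub>R u + b *\<^sub>R v) = A v u (p + a' *\<^sub>R v + b' *\<^sub>R u)" by simp
  moreover have "dist (A u v (p + a *\<^sub>R u + b *\<^sub>R v)) (A u v p) < e"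
    using near(1)[of a b] 1 d1 by (simp add: d_def)
  moreover have "dist (A v u (p + a' *\<^sub>R v + b' *\<^sub>R u)) (A v u p) < e"
    using near(2)[of b' a'] 2 d2 by (simp add: d_def)
  moreover have "\<bar>x - y\<bar> \<le> \<bar>c - x\<bar> + \<bar>c - y\<bar>" for c x y :: real by arith
  ultimately show False unfolding e_def dist_real_def
    by (smt (verit, best) field_sum_of_halves)
qed

text \<open>At a boundary point only directions into the disc can be tested. The difference
  \<open>E\<close> vanishes on \<open>w - z\<close> for every \<open>w\<close> in the disc, so the
  linear map \<open>E\<close> is constant on the disc; the values at 0, 1 and \<open>\<i>\<close>
  then show that it is zero.\<close>

lemma has_derivative_disc_unique:
  fixes k :: "complex \<Rightarrow> real"
  assumes "(k has_derivative A) (at z within disc)" "(k has_derivative B) (at z within disc)" "z \<in> disc"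
  shows "A = B"
proof -
  define E where "E v = A v - B v" for v
  have E: "((\<lambda>_. 0 :: real) has_derivative E) (at z within disc)"
    using has_derivative_diff[OF assms(1,2)] by (simp add: E_def[abs_def])
  have lin: "linear E" by (rule has_derivative_linear[OF E])
  have const: "E w = E z" if w: "w \<in> disc" for w
  proof -
    have sub: "(\<lambda>s. z + s *\<^sub>R (w - z)) ` {0..1} \<subseteq> disc"
    proof clarify
      fix s :: real assume "s \<in> {0..1}"
      then have "(1 - s) *\<^sub>R z + s *\<^sub>R w \<in> disc"
        using assms(3) w convex_cball[of "0::complex" 1] unfolding convex_alt by auto
      then show "z + s *\<^sub>R (w - z) \<in> disc" by (simp add: algebra_simps)
    qed
    have "((\<lambda>s. (\<lambda>_. 0 :: real) (z + s *\<^sub>R (w - z))) has_derivative (\<lambda>s. E (s *\<^sub>R (w - z)))) (at 0 within {0..1})"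
      by (rule has_derivative_in_compose[of "\<lambda>s. z + s *\<^sub>R (w - z)" "\<lambda>s. s *\<^sub>R (w - z)" 0 "{0..1}" "\<lambda>_. 0" E])
        (use has_derivative_subset[OF E sub] in \<open>auto intro!: derivative_eq_intros\<close>)
    then have "((\<lambda>s. 0 :: real) has_vector_derivative E (w - z)) (at 0 within {0..1})"
      by (simp add: has_vector_derivative_def linear_cmul[OF lin])
    then have "E (w - z) = 0"
      using vector_derivative_unique_within_closed_interval[of 0 1 0 "\<lambda>s. 0 :: real" "E (w - z)" 0]
      by simp
    then show ?thesis using linear_diff[OF lin, of w z] by simp
  qed
  have Ez: "E z = 0" using const[of 0] linear_0[OF lin] by simp
  have "E v = 0" for v
  proof -
    have "v = Re v *\<^sub>R 1 + Im v *\<^sub>R \<i>" by (simp add: complex_eq_iff)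
    then have "E v = Re v *\<^sub>R E 1 + Im v *\<^sub>R E \<i>"
      using linear_add[OF lin] linear_cmul[OF lin] by metis
    then show ?thesis using const[of 1] const[of \<i>] Ez by simp
  qed
  then show ?thesis by (simp add: E_def fun_eq_iff)
qed

lemma omega_inject: "(\<lambda>v. - omega u v) = (\<lambda>v. - omega w v) \<Longrightarrow> u = w"
  using fun_cong[of "\<lambda>v. - omega u v" "\<lambda>v. - omega w v" 1] fun_cong[of "\<lambda>v. - omega u v" "\<lambda>v. - omega w v" \<i>]
  by (simp add: omega_eq_det complex_eq_iff)

section \<open>Hamiltonian isotopies as flows on the whole plane\<close>

locale hamiltonian_disc_flow = disc_flow +
  fixes h :: "real \<Rightarrow> complex \<Rightarrow> real"
  assumes h_deriv: "t \<in> {0..1} \<Longrightarrow> (h t has_derivative (\<lambda>v. - omega (Y t z) v)) (at z)"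
    and h_outside: "\<lbrakk>t \<in> {0..1}; 1 \<le> norm z\<rbrakk> \<Longrightarrow> h t z = 0"

text \<open>Because \<open>H\<close> vanishes on a collar of the boundary, extension by zero creates
  no singularity. The regularity of the field is inherited from the smooth extension
  \<open>g\<close> of \<open>H\<close>, since nondegeneracy of \<open>omega\<close> lets the
  Hamiltonian determine its field.\<close>

proposition hamiltonian_isotopy_extension:
  assumes iso: "hamiltonian_isotopy H f"
  obtains Y F L h where "hamiltonian_disc_flow Y F L h"
    "\<And>t z. z \<in> disc \<Longrightarrow> F t z = f t z" "\<And>t z. z \<in> disc \<Longrightarrow> h t z = H t z"
proof -
  obtain X where X: "hamiltonian_vector_field H X" and fl: "flow_of X f"
    using iso by (auto simp: hamiltonian_isotopy_def)
  let ?K = "{0..1::real} \<times> disc"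
  obtain U g where U: "open U" "?K \<subseteq> U" and g: "\<And>k. Ck_on k g U" and gH: "\<And>x. x \<in> ?K \<Longrightarrow> g x = (\<lambda>(t, z). H t z) x"
    using iso unfolding hamiltonian_isotopy_def normalized_hamiltonian_def smooth_on_def by blast
  obtain V where V: "open V" "sphere 0 1 \<subseteq> V" "\<And>t z. \<lbrakk>t \<in> {0..1}; z \<in> V \<inter> disc\<rbrakk> \<Longrightarrow> H t z = 0"
    using iso unfolding hamiltonian_isotopy_def normalized_hamiltonian_def by blast
  \<comment> \<open>The collar contains a full annulus: \<open>disc - V\<close> is compact and
    avoids the circle, so the norm has a maximum below 1 on it. If that set is empty,
    \<open>H\<close> vanishes on the whole disc.\<close>
  obtain r where r: "r < 1" "\<And>t z. \<lbrakk>t \<in> {0..1}; z \<in> disc; r < norm z\<rbrakk> \<Longrightarrow> H t z = 0"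
  proof (cases "disc - V = {}")
    case True
    then show thesis by (intro that[of 0]) (use V(3) in auto)
  next
    case False
    have "compact (disc - V)" using V(1) by (intro compact_diff) auto
    from continuous_attains_sup[OF this False continuous_on_norm_id]
    obtain m where m: "m \<in> disc - V" "\<And>z. z \<in> disc - V \<Longrightarrow> norm z \<le> norm m" by auto
    have "norm m < 1" using m(1) V(2) by (auto simp: subset_iff order_less_le)
    then show thesis using that[of "norm m"] m(2) V(3) by (meson DiffI IntI not_le)
  qed
  define G where "G v p = frechet_derivative g (at p) (0, v)" for v :: complex and p
  have GC: "Ck_on k (G v) U" for k v unfolding G_def by (rule Ck_on_frechet_derivative[OF g])
  note Gder = Ck_on_has_derivative[OF GC]
  \<comment> \<open>The solution of \<open>dg = - omega W\<close> in coordinates: real part minus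
    the derivative of \<open>g\<close> along \<open>\<i>\<close>, imaginary part the derivative
    along 1.\<close>
  define W where "W t z = Complex (- G \<i> (t, z)) (G 1 (t, z))" for t z
  have slice: "((\<lambda>z. k (t, z)) has_derivative (\<lambda>v. Re v * D (0, 1) + Im v * D (0, \<i>))) (at z)"
    if "(k has_derivative D) (at (t, z))" for k :: "real \<times> complex \<Rightarrow> real" and D t z
  proof -
    have lin: "linear D" by (rule has_derivative_linear[OF that])
    have 1: "((\<lambda>z. k (t, z)) has_derivative (\<lambda>v. D (0, v))) (at z)"
      by (rule has_derivative_compose[of "\<lambda>z. (t, z)" "\<lambda>v. (0, v)" z UNIV k D])
        (use that in \<open>auto intro!: derivative_eq_intros\<close>)
    have 2: "D (0, v) = Re v * D (0, 1) + Im v * D (0, \<i>)" for v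
    proof -
      have "(0, v) = Re v *\<^sub>R (0, 1) + Im v *\<^sub>R (0 :: real, \<i>)" by (simp add: complex_eq_iff)
      from arg_cong[OF this, of D] show ?thesis
        by (simp only: linear_add[OF lin] linear_cmul[OF lin] real_scaleR_def)
    qed
    show ?thesis by (rule has_derivative_eq_rhs[OF 1]) (rule ext, rule 2)
  qed
  have inU: "(t, z) \<in> U" if "t \<in> {0..1}" "z \<in> disc" for t z using that U(2) by auto
  have gW: "((\<lambda>z. g (t, z)) has_derivative (\<lambda>v. - omega (W t z) v)) (at z)" if "t \<in> {0..1}" "z \<in> disc" for t z
    using slice[OF Ck_on_has_derivative[OF g inU[OF that]]]
    by (simp add: W_def omega_eq_det G_def mult.commute)
  have HW: "(H t has_derivative (\<lambda>v. - omega (W t z) v)) (at z within disc)" if "t \<in> {0..1}" "z \<in> disc" for t z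
    by (rule has_derivative_transform[OF that(2) _ has_derivative_at_withinI[OF gW[OF that]]])
      (use gH that in auto)
  have XW: "X t z = W t z" if "t \<in> {0..1}" "z \<in> disc" for t z
  proof -
    have "(H t has_derivative (\<lambda>v. - omega (X t z) v)) (at z within disc)"
      using X that by (simp add: hamiltonian_vector_field_def)
    from has_derivative_disc_unique[OF this HW[OF that] that(2)] show ?thesis by (rule omega_inject)
  qed
  have W0: "W t z = 0" if "t \<in> {0..1}" "z \<in> disc" "r < norm z" for t z
  proof -
    have "(H t has_derivative (\<lambda>v. 0)) (at z within disc)"
    proof (rule has_derivative_transform_within[OF has_derivative_const])
      show "0 < norm z - r" using that by simp
      fix w assume "w \<in> disc" "dist w z < norm z - r"
      moreover have "norm z \<le> norm w + dist w z" using norm_triangle_sub[of z w] by (simp add: dist_norm norm_minus_commute)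
      ultimately show "0 = H t w" using r(2)[OF that(1)] by simp
    qed (use that in auto)
    then have "(H t has_derivative (\<lambda>v. - omega 0 v)) (at z within disc)" by (simp add: omega_def)
    from has_derivative_disc_unique[OF HW[OF that(1,2)] this that(2)] show ?thesis by (rule omega_inject)
  qed
  obtain L1 where L1: "0 \<le> L1" "\<And>x y. \<lbrakk>x \<in> ?K; y \<in> ?K\<rbrakk> \<Longrightarrow> norm (G 1 x - G 1 y) \<le> L1 * norm (x - y)"
    by (rule Ck_on_lipschitz[OF GC _ _ U(2)]) (auto intro: compact_Times convex_Times)
  obtain L2 where L2: "0 \<le> L2" "\<And>x y. \<lbrakk>x \<in> ?K; y \<in> ?K\<rbrakk> \<Longrightarrow> norm (G \<i> x - G \<i> y) \<le> L2 * norm (x - y)"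
    by (rule Ck_on_lipschitz[OF GC _ _ U(2)]) (auto intro: compact_Times convex_Times)
  define L where "L = L1 + L2"
  have WL: "norm (W s z - W t w) \<le> L * (\<bar>s - t\<bar> + norm (z - w))"
    if "s \<in> {0..1}" "t \<in> {0..1}" "z \<in> disc" "w \<in> disc" for s t z w
  proof -
    have "norm (W s z - W t w) \<le> \<bar>G \<i> (s, z) - G \<i> (t, w)\<bar> + \<bar>G 1 (s, z) - G 1 (t, w)\<bar>"
      using cmod_le[of "W s z - W t w"] by (simp add: W_def)
    also have "\<dots> \<le> L2 * norm ((s, z) - (t, w)) + L1 * norm ((s, z) - (t, w))"
      using L1(2)[of "(s, z)" "(t, w)"] L2(2)[of "(s, z)" "(t, w)"] that by (intro add_mono) auto
    also have "\<dots> = L * norm (s - t, z - w)" by (simp add: L_def algebra_simps)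
    also have "\<dots> \<le> L * (\<bar>s - t\<bar> + norm (z - w))"
      using L1 L2 norm_Pair_le[of "s - t" "z - w"] by (intro mult_left_mono) (auto simp: L_def)
    finally show ?thesis .
  qed
  define Y where "Y t z = (if z \<in> disc then W t z else 0)" for t z
  define h where "h t z = (if z \<in> disc then H t z else 0)" for t z
  define F where "F t z = (if z \<in> disc then f t z else z)" for t z
  \<comment> \<open>The extension by zero equals \<open>W\<close> composed with the projection to
    the disc, since points outside project to the circle, where \<open>W\<close> vanishes. The
    projection is 1-Lipschitz, so the Lipschitz bound passes to the plane without cases.\<close>
  let ?\<pi> = "closest_point disc"
  have \<pi>: "?\<pi> z \<in> disc" for z by (rule closest_point_in_set) auto
  have Y_proj: "Y t z = W t (?\<pi> z)" if "t \<in> {0..1}" for t z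
  proof (cases "z \<in> disc")
    case False
    have ne: "interior disc \<noteq> {}" by simp
    have "?\<pi> z \<in> rel_frontier disc"
      using False by (intro closest_point_in_rel_frontier)
        (auto simp: rel_interior_nonempty_interior[OF ne] affine_hull_nonempty_interior[OF ne])
    then have "norm (?\<pi> z) = 1" by (simp add: rel_frontier_nonempty_interior[OF ne])
    then show ?thesis using W0[OF that \<pi>, of z] r(1) False by (simp add: Y_def)
  qed (simp add: Y_def closest_point_self)
  have Yder_in: "\<exists>a b c. (Y t has_derivative (\<lambda>v. Complex (a * Re v + b * Im v) (c * Re v - a * Im v))) (at z)"
    if t: "t \<in> {0..1}" and z: "norm z < 1" for t z
  proof -
    have p: "(t, z) \<in> U" using inU t z by auto
    let ?D = "\<lambda>v. frechet_derivative (G v) (at (t, z))"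
    \<comment> \<open>Up to sign these are the two diagonal entries of the Jacobian of
      \<open>W\<close>; their equality is the vanishing of the trace.\<close>
    have "?D 1 (0, \<i>) = ?D \<i> (0, 1)"
      using symmetric_second_derivative[OF g U(1) p, of "(0, 1)" "(0, \<i>)"] by (simp add: G_def[abs_def])
    moreover have "(W t has_derivative (\<lambda>v. - (Re v * ?D \<i> (0, 1) + Im v * ?D \<i> (0, \<i>)) *\<^sub>R 1
         + (Re v * ?D 1 (0, 1) + Im v * ?D 1 (0, \<i>)) *\<^sub>R \<i>)) (at z)"
    proof -
      have "W t = (\<lambda>z. (- G \<i> (t, z)) *\<^sub>R 1 + G 1 (t, z) *\<^sub>R \<i>)"
        by (auto simp: W_def fun_eq_iff complex_eq_iff)
      then show ?thesis
        by (auto intro!: derivative_eq_intros slice[OF Gder[OF p]] simp: algebra_simps)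
    qed
    ultimately have "(W t has_derivative (\<lambda>v. Complex (- ?D \<i> (0, 1) * Re v + - ?D \<i> (0, \<i>) * Im v)
        (?D 1 (0, 1) * Re v - - ?D \<i> (0, 1) * Im v))) (at z)"
      by (elim has_derivative_eq_rhs) (auto simp: fun_eq_iff complex_eq_iff)
    then have "(Y t has_derivative (\<lambda>v. Complex (- ?D \<i> (0, 1) * Re v + - ?D \<i> (0, \<i>) * Im v)
        (?D 1 (0, 1) * Re v - - ?D \<i> (0, 1) * Im v))) (at z)"
      by (rule has_derivative_transform_within_open[of _ _ _ UNIV "ball 0 1"]) (use z in \<open>auto simp: Y_def\<close>)
    then show ?thesis by blast
  qed
  \<comment> \<open>On this open set the extended field and Hamiltonian vanish. Together with the
    open unit disc it covers the plane, so boundary points are interior to a region where all is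
    zero.\<close>
  have out_open: "open {z :: complex. r < norm z}" by (intro open_Collect_less continuous_intros)
  interpret flow: hamiltonian_disc_flow Y F L h
  proof
    show "0 \<le> L" using L1 L2 by (simp add: L_def)
    show "norm (Y s z - Y t w) \<le> L * (\<bar>s - t\<bar> + norm (z - w))" if st: "s \<in> {0..1}" "t \<in> {0..1}" for s t z w
    proof -
      have "norm (Y s z - Y t w) \<le> L * (\<bar>s - t\<bar> + norm (?\<pi> z - ?\<pi> w))"
        unfolding Y_proj[OF st(1)] Y_proj[OF st(2)] by (rule WL[OF st \<pi> \<pi>])
      also have "\<dots> \<le> L * (\<bar>s - t\<bar> + norm (z - w))"
        using closest_point_lipschitz[of disc z w] \<open>0 \<le> L\<close>
        by (intro mult_left_mono add_left_mono) (auto simp: dist_norm)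
      finally show ?thesis .
    qed
    show "Y t z = 0" if "t \<in> {0..1}" "1 \<le> norm z" for t z
      using that W0[of t z] r(1) by (auto simp: Y_def)
    show "h t z = 0" if "t \<in> {0..1}" "1 \<le> norm z" for t z
      using that r by (auto simp: h_def)
    show "\<exists>a b c. (Y t has_derivative (\<lambda>v. Complex (a * Re v + b * Im v) (c * Re v - a * Im v))) (at z)"
      if t: "t \<in> {0..1}" for t z
    proof (cases "norm z < 1")
      case False
      have "(Y t has_derivative (\<lambda>v. 0)) (at z)"
        by (rule has_derivative_transform_within_open[OF has_derivative_const out_open])
          (use False r(1) W0[OF t] in \<open>auto simp: Y_def\<close>)
      then have "(Y t has_derivative (\<lambda>v. Complex (0 * Re v + 0 * Im v) (0 * Re v - 0 * Im v))) (at z)"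
        by (simp add: zero_complex.code[symmetric])
      then show ?thesis by blast
    qed (rule Yder_in[OF t])
    show "F 0 z = z" for z using fl by (auto simp: F_def flow_of_def)
    show "((\<lambda>s. F s z) has_vector_derivative Y t (F t z)) (at t within {0..1})" if t: "t \<in> {0..1}" for t z
    proof (cases "z \<in> disc")
      case True
      then have "f t z \<in> disc" "((\<lambda>s. f s z) has_vector_derivative X t (f t z)) (at t within {0..1})"
        using fl t by (auto simp: flow_of_def)
      then show ?thesis using True XW[OF t] by (simp add: F_def Y_def)
    qed (simp add: F_def Y_def)
    show "F t z \<in> disc" if "t \<in> {0..1}" "z \<in> disc" for t z
      using that fl by (auto simp: F_def flow_of_def)
    show "(h t has_derivative (\<lambda>v. - omega (Y t z) v)) (at z)" if t: "t \<in> {0..1}" for t z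
    proof (cases "norm z < 1")
      case True
      then have "(h t has_derivative (\<lambda>v. - omega (W t z) v)) (at z)"
        by (intro has_derivative_transform_within_open[OF gW[OF t] open_ball[of 0 1]])
          (use gH t in \<open>auto simp: h_def\<close>)
      then show ?thesis using True by (simp add: Y_def)
    next
      case False
      then have "Y t z = 0" using r(1) W0[OF t] by (auto simp: Y_def)
      moreover have "(h t has_derivative (\<lambda>v. 0)) (at z)"
        by (rule has_derivative_transform_within_open[OF has_derivative_const out_open])
          (use False r t in \<open>auto simp: h_def\<close>)
      ultimately show ?thesis by (simp add: omega_def)
    qed
  qed
  show thesis
    by (rule that[of Y F L h]) (auto simp: F_def h_def flow.hamiltonian_disc_flow_axioms)
qed

section \<open>Winding of pairs of orbits\<close>

context disc_flow
begin

text \<open>The logarithmic derivative in time of the difference of two orbits. On the diagonal,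
  division by zero gives 0, so that the bound by \<open>L\<close> holds for all pairs.\<close>

definition log_deriv :: "real \<Rightarrow> complex \<times> complex \<Rightarrow> complex" where
  "log_deriv t x = (Y t (F t (fst x)) - Y t (F t (snd x))) / (F t (fst x) - F t (snd x))"

text \<open>For distinct points this is the total change of the argument of the difference of their
  orbits, as a real number and not modulo 2 pi.\<close>

definition winding :: "complex \<times> complex \<Rightarrow> real" where
  "winding x = integral {0..1} (\<lambda>t. Im (log_deriv t x))"

lemma log_deriv_bound: "t \<in> {0..1} \<Longrightarrow> norm (log_deriv t x) \<le> L"
  using Y_lipschitz_space[of t "F t (fst x)" "F t (snd x)"] L0
  by (cases "F t (fst x) = F t (snd x)") (auto simp: log_deriv_def norm_divide divide_le_eq)

lemma Y_continuous_joint: "continuous_on ({0..1} \<times> UNIV) (\<lambda>(t, z). Y t z)"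
proof (rule lipschitz_on_continuous_on[of "2 * L"], rule lipschitz_onI)
  fix p q :: "real \<times> complex" assume "p \<in> {0..1} \<times> UNIV" "q \<in> {0..1} \<times> UNIV"
  then have "norm (Y (fst p) (snd p) - Y (fst q) (snd q)) \<le> L * (norm (fst p - fst q) + norm (snd p - snd q))"
    using Y_lipschitz[of "fst p" "fst q" "snd p" "snd q"] by auto
  also have "\<dots> \<le> L * (norm (p - q) + norm (p - q))"
    using dist_fst_le[of p q, unfolded dist_norm] dist_snd_le[of p q, unfolded dist_norm] L0
    by (intro mult_left_mono add_mono) auto
  finally show "dist (case p of (t, z) \<Rightarrow> Y t z) (case q of (t, z) \<Rightarrow> Y t z) \<le> 2 * L * dist p q"
    by (simp add: dist_norm case_prod_beta)
qed (use L0 in auto)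

lemma F_continuous_joint: "continuous_on ({0..1} \<times> UNIV) (\<lambda>(t, z). F t z)"
proof (rule lipschitz_on_continuous_on[of "3 * L + exp L"], rule lipschitz_onI)
  fix p q :: "real \<times> complex" assume pq: "p \<in> {0..1} \<times> UNIV" "q \<in> {0..1} \<times> UNIV"
  then have t: "fst p \<in> {0..1}" "fst q \<in> {0..1}" by auto
  have "norm (F (fst p) (snd p) - F (fst q) (snd q)) \<le>
      norm (F (fst p) (snd p) - F (fst q) (snd p)) + norm (F (fst q) (snd p) - F (fst q) (snd q))"
    using norm_triangle_ineq[of "F (fst p) (snd p) - F (fst q) (snd p)" "F (fst q) (snd p) - F (fst q) (snd q)"] by simp
  also have "\<dots> \<le> 3 * L * norm (fst p - fst q) + exp (L * fst q) * norm (snd p - snd q)"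
    using F_lipschitz_time[OF t] F_lipschitz_space[OF t(2)] by (intro add_mono) auto
  also have "\<dots> \<le> 3 * L * norm (p - q) + exp L * norm (p - q)"
    using dist_fst_le[of p q, unfolded dist_norm] dist_snd_le[of p q, unfolded dist_norm] L0 t
    by (intro add_mono mult_mono) (auto simp: mult_left_le)
  finally show "dist (case p of (t, z) \<Rightarrow> F t z) (case q of (t, z) \<Rightarrow> F t z) \<le> (3 * L + exp L) * dist p q"
    by (simp add: dist_norm case_prod_beta algebra_simps)
qed (use L0 in auto)

lemma log_deriv_continuous:
  assumes S: "\<And>x. x \<in> S \<Longrightarrow> fst x \<noteq> snd x"
  shows "continuous_on (S \<times> {0..1}) (\<lambda>(x, t). log_deriv t x)"
proof -
  have F: "continuous_on (S \<times> {0..1}) (\<lambda>p. F (snd p) (k (fst p)))"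
    if "continuous_on S k" for k :: "complex \<times> complex \<Rightarrow> complex"
    by (rule continuous_on_compose2[OF F_continuous_joint, of _ "\<lambda>p. (snd p, k (fst p))", simplified])
      (auto intro!: continuous_intros continuous_on_compose2[OF that])
  have Y: "continuous_on (S \<times> {0..1}) (\<lambda>p. Y (snd p) (F (snd p) (k (fst p))))"
    if "continuous_on S k" for k :: "complex \<times> complex \<Rightarrow> complex"
    by (rule continuous_on_compose2[OF Y_continuous_joint, of _ "\<lambda>p. (snd p, F (snd p) (k (fst p)))", simplified])
      (auto intro!: continuous_intros F that)
  have c: "continuous_on S fst" "continuous_on S snd" by (intro continuous_intros)+
  show ?thesis
    unfolding log_deriv_def case_prod_beta
    by (intro continuous_intros F Y c) (use S F_inj in auto)
qed

lemma log_deriv_continuous_time: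
  assumes "fst x \<noteq> snd x"
  shows "continuous_on {0..1} (\<lambda>t. log_deriv t x)"
proof -
  have "continuous_on ({x} \<times> {0..1}) (\<lambda>p. log_deriv (snd p) (fst p))"
    using log_deriv_continuous[of "{x}"] assms by (simp add: case_prod_beta)
  then have "continuous_on {0..1} (\<lambda>t. (\<lambda>p. log_deriv (snd p) (fst p)) (x, t))"
    by (rule continuous_on_compose2) (auto intro!: continuous_intros)
  then show ?thesis by simp
qed

lemma winding_continuous:
  assumes "\<And>x. x \<in> S \<Longrightarrow> fst x \<noteq> snd x"
  shows "continuous_on S winding"
proof -
  have "continuous_on (S \<times> {0..1}) (\<lambda>(x, t). Im (log_deriv t x))"
    using continuous_on_Im[OF log_deriv_continuous[OF assms]] by (simp add: case_prod_beta)
  then show ?thesis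
    using integral_continuous_on_param[of S 0 1 "\<lambda>x t. Im (log_deriv t x)"]
    by (simp add: winding_def[abs_def])
qed

lemma log_deriv_commute: "log_deriv t (a, b) = log_deriv t (b, a)"
  unfolding log_deriv_def by (metis fst_conv snd_conv minus_diff_eq minus_divide_divide)

lemma winding_commute: "winding (a, b) = winding (b, a)"
  by (simp add: winding_def log_deriv_commute)

lemma winding_boundary: "\<lbrakk>1 \<le> norm a; 1 \<le> norm b\<rbrakk> \<Longrightarrow> winding (a, b) = 0"
  using integral_cong[of "{0..1}" "\<lambda>t. Im (log_deriv t (a, b))" "\<lambda>_. 0"]
  by (simp add: winding_def log_deriv_def F_outside Y_outside)

text \<open>The difference \<open>u\<close> of the orbits solves \<open>u' = k u\<close> with
  \<open>k\<close> its logarithmic derivative, so \<open>u\<close> times the exponential of minus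
  the integral of \<open>k\<close> is constant. In particular the time-one map determines the
  winding modulo 2 pi.\<close>

lemma exp_integral_log_deriv:
  assumes ne: "a \<noteq> b"
  shows "F 1 a - F 1 b = (a - b) * exp (integral {0..1} (\<lambda>t. log_deriv t (a, b)))"
proof -
  let ?k = "\<lambda>t. log_deriv t (a, b)"
  let ?u = "\<lambda>t. F t a - F t b"
  define E where "E t = exp (- integral {0..t} ?k)" for t
  have dE: "(E has_vector_derivative (- ?k t * E t)) (at t within {0..1})" if "t \<in> {0..1}" for t
  proof -
    have "((\<lambda>s. - integral {0..s} ?k) has_vector_derivative - ?k t) (at t within {0..1})"
      by (intro has_vector_derivative_minus integral_has_vector_derivative log_deriv_continuous_time that)
        (use ne in auto)
    from field_vector_diff_chain_within[OF this, of exp "exp (- integral {0..t} ?k)"] show ?thesis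
      by (simp add: E_def[abs_def] o_def has_field_derivative_at_within)
  qed
  have "((\<lambda>t. ?u t * E t) has_vector_derivative 0) (at t within {0..1})" if t: "t \<in> {0..1}" for t
  proof -
    have du: "(?u has_vector_derivative (Y t (F t a) - Y t (F t b))) (at t within {0..1})"
      by (intro has_vector_derivative_diff F_deriv t)
    have "Y t (F t a) - Y t (F t b) = ?k t * ?u t"
      using F_inj[OF t, of a b] ne by (simp add: log_deriv_def)
    with has_vector_derivative_mult[OF du dE[OF t]] show ?thesis
      by (simp add: algebra_simps)
  qed
  then obtain c where c: "\<And>t. t \<in> {0..1} \<Longrightarrow> ?u t * E t = c"
    using has_vector_derivative_zero_constant[of "{0..1}" "\<lambda>t. ?u t * E t"] by auto
  have "?u 1 * E 1 = ?u 0 * E 0" using c[of 0] c[of 1] by simp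
  then show ?thesis by (simp add: E_def exp_minus field_simps)
qed

lemma Im_integral_log_deriv:
  assumes "a \<noteq> b"
  shows "Im (integral {0..1} (\<lambda>t. log_deriv t (a, b))) = winding (a, b)"
proof -
  have "(\<lambda>t. log_deriv t (a, b)) integrable_on {0..1}"
    by (intro integrable_continuous_interval log_deriv_continuous_time) (use assms in auto)
  from integral_linear[OF this bounded_linear_Im] show ?thesis
    by (simp add: winding_def o_def)
qed

end

section \<open>The winding of a pair as a function of the time-one map\<close>

lemma integer_step_function_const:
  fixes d :: "complex \<Rightarrow> real"
  assumes "connected S" "continuous_on S d" "0 < q" "\<And>x. x \<in> S \<Longrightarrow> \<exists>n::int. d x = q * of_int n" "x \<in> S" "y \<in> S"
  shows "d x = d y"
proof -
  have "d constant_on S"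
  proof (rule continuous_discrete_range_constant[OF assms(1,2)])
    fix x assume x: "x \<in> S"
    have "q \<le> norm (d y - d x)" if y: "y \<in> S" "d y \<noteq> d x" for y
    proof -
      obtain n m where nm: "d x = q * of_int n" "d y = q * of_int m" using assms(4) x y by metis
      then have "n \<noteq> m" using y by auto
      then have "1 \<le> \<bar>real_of_int m - real_of_int n\<bar>" by linarith
      then show ?thesis using nm assms(3) mult_left_mono[of 1 "\<bar>real_of_int m - real_of_int n\<bar>" q]
        by (simp add: right_diff_distrib[symmetric] abs_mult)
    qed
    then show "\<exists>e>0. \<forall>y. y \<in> S \<and> d y \<noteq> d x \<longrightarrow> e \<le> norm (d y - d x)" using assms(3) by blast
  qed
  then show ?thesis using assms(5,6) by (auto simp: constant_on_def)
qed

lemma connected_disc_minus_point: "connected (disc - {a})"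
proof (rule connected_convex_diff_countable)
  have "\<not> collinear {0, 1, \<i>}" by (auto simp: collinear_lemma complex_eq_iff)
  moreover have "{0, 1, \<i>} \<subseteq> disc" by auto
  ultimately show "\<not> collinear disc" using collinear_subset by blast
qed auto

text \<open>Both windings lift the same endpoint argument, so their difference is a continuous function with
  values in \<open>2 * pi * \<int>\<close>; moving the two points one after the other to the boundary, where both
  flows are stationary, shows that it vanishes.\<close>

lemma winding_unique:
  assumes fl: "disc_flow Y F L" and fl': "disc_flow Y' F' L'"
    and eq: "\<And>z. z \<in> disc \<Longrightarrow> F 1 z = F' 1 z"
    and ab: "a \<in> disc" "b \<in> disc" "a \<noteq> b"
  shows "disc_flow.winding Y F (a, b) = disc_flow.winding Y' F' (a, b)"
proof -
  interpret A: disc_flow Y F L by (rule fl)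
  interpret B: disc_flow Y' F' L' by (rule fl')
  define d where "d x = A.winding x - B.winding x" for x
  have int: "\<exists>n::int. d (a, b) = 2 * pi * of_int n" if "a \<in> disc" "b \<in> disc" "a \<noteq> b" for a b
  proof -
    let ?A = "integral {0..1} (\<lambda>t. A.log_deriv t (a, b))" and ?B = "integral {0..1} (\<lambda>t. B.log_deriv t (a, b))"
    have "(a - b) * exp ?A = (a - b) * exp ?B"
      using A.exp_integral_log_deriv B.exp_integral_log_deriv eq that by metis
    then have "exp ?A = exp ?B" using that by simp
    then obtain n :: int where "?A = ?B + (of_int (2 * n) * pi) * \<i>" unfolding exp_eq by blast
    then have "Im ?A = Im ?B + 2 * pi * of_int n" by simp
    then show ?thesis
      using A.Im_integral_log_deriv B.Im_integral_log_deriv that by (auto simp: d_def)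
  qed
  have move: "d (a, b) = d (a, c)" if "a \<in> disc" "b \<in> disc - {a}" "c \<in> disc - {a}" for a b c
  proof (rule integer_step_function_const[OF connected_disc_minus_point, of a "\<lambda>b. d (a, b)" "2 * pi"])
    have "continuous_on ({a} \<times> (disc - {a})) d"
      unfolding d_def by (intro continuous_on_diff A.winding_continuous B.winding_continuous) auto
    then show "continuous_on (disc - {a}) (\<lambda>b. d (a, b))"
      by (rule continuous_on_compose2) (auto intro!: continuous_intros)
  qed (use int that in auto)
  have swap: "d (a, b) = d (b, a)" for a b
    by (simp add: d_def A.winding_commute[of a] B.winding_commute[of a])
  \<comment> \<open>One of 1 and -1 differs from \<open>a\<close>, which leaves room to move
    \<open>b\<close> to \<open>c\<close>. Then \<open>a\<close> is moved to the antipode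
    \<open>- c\<close>, which never meets \<open>c\<close>.\<close>
  obtain c :: complex where c: "norm c = 1" "c \<noteq> a"
    using that[of 1] that[of "-1"] by (cases "a = 1") auto
  have "d (a, b) = d (a, c)" using ab c by (intro move) auto
  also have "\<dots> = d (c, a)" by (rule swap)
  also have "\<dots> = d (c, - c)" using ab c by (intro move) auto
  also have "\<dots> = 0" using c by (simp add: d_def A.winding_boundary B.winding_boundary)
  finally show ?thesis by (simp add: d_def)
qed

context disc_flow
begin

lemma line_integral_theta:
  assumes ab: "a \<noteq> b"
    and F: "\<And>t. t \<in> {0..1} \<Longrightarrow> f t a = F t a" "\<And>t. t \<in> {0..1} \<Longrightarrow> f t b = F t b"
  shows "line_integral theta (\<lambda>t. (f t a, f t b)) = winding (a, b) / (2 * pi)"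
proof -
  have th: "theta (f t a, f t b) (vector_derivative (\<lambda>t. (f t a, f t b)) (at t within {0..1})) =
      Im (log_deriv t (a, b)) / (2 * pi)" if t: "t \<in> {0..1}" for t
  proof -
    have "((\<lambda>t. (F t a, F t b)) has_vector_derivative (Y t (F t a), Y t (F t b))) (at t within {0..1})"
      by (intro has_vector_derivative_Pair F_deriv t)
    then have "((\<lambda>t. (f t a, f t b)) has_vector_derivative (Y t (F t a), Y t (F t b))) (at t within {0..1})"
      by (rule has_vector_derivative_transform[OF t, rotated]) (use F in auto)
    then have "vector_derivative (\<lambda>t. (f t a, f t b)) (at t within {0..1}) = (Y t (F t a), Y t (F t b))"
      using t by (intro vector_derivative_within_cbox[of 0 1, simplified]) auto
    then have "alpha (f t a, f t b) (vector_derivative (\<lambda>t. (f t a, f t b)) (at t within {0..1})) =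
        of_real (1 / (2 * pi)) * log_deriv t (a, b)"
      using F[OF t] by (simp add: alpha_def log_deriv_def)
    then show ?thesis by (simp only: theta_def times_complex.sel) simp
  qed
  have "line_integral theta (\<lambda>t. (f t a, f t b)) = (LINT t:{0..1}|lborel. Im (log_deriv t (a, b)) / (2 * pi))"
    unfolding line_integral_def by (rule set_lebesgue_integral_cong) (use th in auto)
  also have "\<dots> = (LINT t:{0..1}|lborel. Im (log_deriv t (a, b))) / (2 * pi)"
    by simp
  also have "(LINT t:{0..1}|lborel. Im (log_deriv t (a, b))) = winding (a, b)"
    unfolding winding_def
    by (intro set_borel_integral_eq_integral borel_integrable_atLeastAtMost' continuous_on_Im log_deriv_continuous_time)
      (use ab in auto)
  finally show ?thesis .
qed

end

text \<open>The two integrands agree pair by pair on \<open>X2\<close>, as the winding of each pair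
  depends on the time-one map only.\<close>

lemma rotation_integral_unique:
  assumes fl: "disc_flow Y F L" and fl': "disc_flow Y' F' L'"
    and f: "\<And>t z. z \<in> disc \<Longrightarrow> F t z = f t z" and f': "\<And>t z. z \<in> disc \<Longrightarrow> F' t z = f' t z"
    and eq: "\<And>z. z \<in> disc \<Longrightarrow> f 1 z = f' 1 z"
  shows "rotation_integral f = rotation_integral f'"
  unfolding rotation_integral_def
proof (rule set_lebesgue_integral_cong)
  have ne: "{p :: complex \<times> complex. fst p \<noteq> snd p} \<in> sets borel"
    by (intro borel_open open_Collect_neq continuous_intros)
  have X2: "X2 = (disc \<times> disc) \<inter> {p. fst p \<noteq> snd p}"
    by (auto simp: X2_def)
  have "X2 \<in> sets borel"
    unfolding X2 by (intro sets.Int ne borel_closed closed_Times closed_cball)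
  then show "X2 \<in> sets (lborel \<Otimes>\<^sub>M lborel)" by (simp only: lborel_prod sets_lborel)
  show "\<forall>x. x \<in> X2 \<longrightarrow> line_integral theta (\<lambda>t. (f t (fst x), f t (snd x))) =
      line_integral theta (\<lambda>t. (f' t (fst x), f' t (snd x)))"
  proof clarify
    fix a b assume "(a, b) \<in> X2"
    then have ab: "a \<in> disc" "b \<in> disc" "a \<noteq> b" by (auto simp: X2_def)
    then show "line_integral theta (\<lambda>t. (f t (fst (a, b)), f t (snd (a, b)))) =
      line_integral theta (\<lambda>t. (f' t (fst (a, b)), f' t (snd (a, b))))"
      using disc_flow.line_integral_theta[OF fl ab(3), of f] disc_flow.line_integral_theta[OF fl' ab(3), of f']
        winding_unique[OF fl fl' _ ab] f f' eq by simp
  qed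
qed

section \<open>The average rotation number\<close>

context hamiltonian_disc_flow
begin

abbreviation kernel :: "real \<Rightarrow> complex \<times> complex \<Rightarrow> real" where
  "kernel t x \<equiv> Im ((Y t (fst x) - Y t (snd x)) / (fst x - snd x))"

text \<open>For a fixed pole \<open>w = fst x\<close> in the disc, the translation
  \<open>z = w + y\<close> turns the integral over \<open>z = snd x\<close> into the Cauchy-Pompeiu
  integral of the recentred Hamiltonian \<open>h t (w + y)\<close>. The indicator restricts the pole
  only; the other point is confined to the disc by the support of \<open>Y t\<close>.\<close>

lemma half_kernel:
  fixes t :: real
  assumes t: "t \<in> {0..1}"
  defines "a \<equiv> \<lambda>x :: complex \<times> complex. indicator disc (fst x) * Im (Y t (snd x) / (snd x - fst x))"
  shows "integrable (lborel \<Otimes>\<^sub>M lborel) a" 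
    and "integral\<^sup>L (lborel \<Otimes>\<^sub>M lborel) a = - 2 * pi * (LINT w:disc|lborel. h t w)"
proof -
  have Ym [measurable]: "Y t \<in> borel_measurable borel"
    by (rule borel_measurable_continuous_onI[OF Y_continuous[OF t]])
  have am: "a \<in> borel_measurable (lborel \<Otimes>\<^sub>M lborel)"
  proof -
    have "a = (\<lambda>x. if norm (fst x) \<le> 1 then Im (Y t (snd x) / (snd x - fst x)) else 0)"
      by (auto simp: a_def fun_eq_iff)
    then show ?thesis by simp
  qed
  \<comment> \<open>The field is bounded by \<open>3 * L\<close>, and after recentring at a point of
    the disc it vanishes from radius 2 on.\<close>
  have cp: "(\<integral>\<^sup>+y. ennreal \<bar>Im (Y t (w + y) / y)\<bar> \<partial>lborel) \<le> ennreal (2 * (3 * L) * 2 * pi)"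
      "(LINT y|lborel. Im (Y t (w + y) / y)) = - 2 * pi * h t w" if w: "norm w \<le> 1" for w
  proof -
    have d: "((\<lambda>y. h t (w + y)) has_derivative (\<lambda>v. - omega (Y t (w + y)) v)) (at y)" for y
      by (rule has_derivative_compose[of "\<lambda>y. w + y" "\<lambda>v. v" y UNIV "h t"])
        (auto intro!: derivative_eq_intros h_deriv t)
    have c: "continuous_on UNIV (\<lambda>y. Y t (w + y))"
      by (intro continuous_on_compose2[OF Y_continuous[OF t]] continuous_intros) auto
    have far: "1 \<le> norm (w + y)" if "2 \<le> norm y" for y
      using norm_triangle_ineq4[of "w + y" w] that w by simp
    note * = d c Y_outside[OF t far] h_outside[OF t far] Y_bound[OF t]
    show "(\<integral>\<^sup>+y. ennreal \<bar>Im (Y t (w + y) / y)\<bar> \<partial>lborel) \<le> ennreal (2 * (3 * L) * 2 * pi)"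
      by (rule nn_integral_cauchy_kernel[OF *]) auto
    show "(LINT y|lborel. Im (Y t (w + y) / y)) = - 2 * pi * h t w"
      using cauchy_pompeiu[OF *] by simp
  qed
  have shift: "lborel = distr lborel borel ((+) w)" for w :: complex
    by (rule lborel_distr_plus[symmetric])
  have nn: "(\<integral>\<^sup>+z. ennreal \<bar>a (w, z)\<bar> \<partial>lborel) \<le> ennreal (2 * (3 * L) * 2 * pi) * indicator disc w" for w
  proof (cases "norm w \<le> 1")
    case True
    have "(\<integral>\<^sup>+z. ennreal \<bar>a (w, z)\<bar> \<partial>lborel) = (\<integral>\<^sup>+z. ennreal \<bar>Im (Y t z / (z - w))\<bar> \<partial>lborel)"
      using True by (simp add: a_def)
    also have "\<dots> = (\<integral>\<^sup>+y. ennreal \<bar>Im (Y t (w + y) / y)\<bar> \<partial>lborel)"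
      by (subst shift[of w], subst nn_integral_distr) auto
    finally show ?thesis using cp(1)[OF True] True by simp
  qed (simp add: a_def)
  have "(\<integral>\<^sup>+x. ennreal (norm (a x)) \<partial>(lborel \<Otimes>\<^sub>M lborel)) = (\<integral>\<^sup>+w. \<integral>\<^sup>+z. ennreal \<bar>a (w, z)\<bar> \<partial>lborel \<partial>lborel)"
    using am by (subst lborel.nn_integral_fst[symmetric]) auto
  also have "\<dots> \<le> (\<integral>\<^sup>+w. ennreal (2 * (3 * L) * 2 * pi) * indicator disc (w :: complex) \<partial>lborel)"
    by (rule nn_integral_mono) (rule nn)
  also have "\<dots> < \<infinity>"
    by (subst nn_integral_cmult_indicator) (auto simp: ennreal_mult_less_top emeasure_lborel_cball_finite[simplified])
  finally show int: "integrable (lborel \<Otimes>\<^sub>M lborel) a"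
    using am by (intro integrableI_bounded) auto
  have "integral\<^sup>L (lborel \<Otimes>\<^sub>M lborel) a = (LINT w|lborel. (LINT z|lborel. a (w, z)))"
    by (rule lborel_pair.integral_fst'[symmetric, OF int])
  also have "\<dots> = (LINT w|lborel. (- 2 * pi) * (indicator disc w *\<^sub>R h t w))"
  proof (rule Bochner_Integration.integral_cong[OF refl])
    fix w :: complex
    show "(LINT z|lborel. a (w, z)) = (- 2 * pi) * (indicator disc w *\<^sub>R h t w)"
    proof (cases "norm w \<le> 1")
      case True
      have "(LINT z|lborel. a (w, z)) = (LINT z|lborel. Im (Y t z / (z - w)))"
        using True by (simp add: a_def)
      also have "\<dots> = (LINT y|lborel. Im (Y t (w + y) / y))"
        by (subst shift[of w], subst integral_distr) auto
      finally show ?thesis using cp(2)[OF True] True by simp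
    qed (simp add: a_def)
  qed
  also have "\<dots> = - 2 * pi * (LINT w:disc|lborel. h t w)"
    by (simp add: set_lebesgue_integral_def)
  finally show "integral\<^sup>L (lborel \<Otimes>\<^sub>M lborel) a = - 2 * pi * (LINT w:disc|lborel. h t w)" .
qed

text \<open>The kernel splits into \<open>Y t z / (z - w)\<close> and
  \<open>Y t w / (w - z)\<close>. Each half is integrable by itself and the swap of the points
  exchanges them, so the value of one half is doubled.\<close>

lemma integral_kernel:
  assumes t: "t \<in> {0..1}"
  shows "(LINT x:disc \<times> disc|lborel \<Otimes>\<^sub>M lborel. kernel t x) = - 4 * pi * (LINT w:disc|lborel. h t w)"
proof -
  define a where "a x = indicator disc (fst x) * Im (Y t (snd x) / (snd x - fst x))" for x :: "complex \<times> complex"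
  note A = half_kernel[OF t, folded a_def[abs_def]]
  have "(LINT x:disc \<times> disc|lborel \<Otimes>\<^sub>M lborel. kernel t x) = (LINT x|(lborel \<Otimes>\<^sub>M lborel). a x + (case x of (z, w) \<Rightarrow> a (w, z)))"
    unfolding set_lebesgue_integral_def
  proof (rule Bochner_Integration.integral_cong[OF refl], clarify)
    fix z w :: complex
    have "Y t v = indicator disc v *\<^sub>R Y t v" for v using Y_outside[OF t, of v] by (auto simp: indicator_def)
    moreover have "Y t w / (w - z) = - (Y t w / (z - w))"
      by (metis minus_diff_eq divide_minus_right)
    ultimately show "indicator (disc \<times> disc) (z, w) *\<^sub>R kernel t (z, w) = a (z, w) + a (w, z)"
      using Y_outside[OF t, of z] Y_outside[OF t, of w]
      by (auto simp: a_def indicator_def diff_divide_distrib)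
  qed
  also have "\<dots> = integral\<^sup>L (lborel \<Otimes>\<^sub>M lborel) a + (LINT x|(lborel \<Otimes>\<^sub>M lborel). (case x of (z, w) \<Rightarrow> a (w, z)))"
    by (rule Bochner_Integration.integral_add[OF A(1) lborel_pair.integrable_product_swap[OF A(1)]])
  also have "(LINT x|(lborel \<Otimes>\<^sub>M lborel). (case x of (z, w) \<Rightarrow> a (w, z))) = integral\<^sup>L (lborel \<Otimes>\<^sub>M lborel) a"
    by (rule lborel_pair.integral_product_swap) (use A(1) in auto)
  finally show ?thesis using A(2) by simp
qed

text \<open>\<open>log_deriv\<close> is the static difference quotient evaluated at the moved pair.
  The flow acting on both points preserves the product measure, by Liouville, and maps exactly the
  pairs in \<open>disc \<times> disc\<close> into that set, so it can be substituted away.\<close>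

lemma integral_log_deriv:
  assumes t: "t \<in> {0..1}"
  shows "(LINT x:disc \<times> disc|lborel \<Otimes>\<^sub>M lborel. Im (log_deriv t x)) = - 4 * pi * (LINT w:disc|lborel. h t w)"
proof -
  note [measurable] = borel_measurable_continuous_onI[OF Y_continuous[OF t]] F_measurable[OF t]
  let ?FF = "\<lambda>(z, w). (F t z, F t w)"
  define k where "k x = (if norm (fst x) \<le> 1 \<and> norm (snd x) \<le> 1 then kernel t x else 0)" for x
  have km [measurable]: "k \<in> borel_measurable (borel \<Otimes>\<^sub>M borel)" unfolding k_def by measurable
  have k: "k x = indicator (disc \<times> disc) x *\<^sub>R kernel t x" for x
    by (cases x) (auto simp: k_def indicator_def)
  have "lborel \<Otimes>\<^sub>M lborel = distr lborel borel (F t) \<Otimes>\<^sub>M distr lborel borel (F t)"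
    by (simp add: liouville[OF t])
  also have "\<dots> = distr (lborel \<Otimes>\<^sub>M lborel) (borel \<Otimes>\<^sub>M borel) ?FF"
    by (rule pair_measure_distr) (auto simp: liouville[OF t] sigma_finite_lborel)
  finally have D: "lborel \<Otimes>\<^sub>M lborel = distr (lborel \<Otimes>\<^sub>M lborel) (borel \<Otimes>\<^sub>M borel) ?FF" .
  have "(LINT x:disc \<times> disc|lborel \<Otimes>\<^sub>M lborel. Im (log_deriv t x)) = (LINT x|(lborel \<Otimes>\<^sub>M lborel). k (?FF x))"
    unfolding set_lebesgue_integral_def
    by (rule Bochner_Integration.integral_cong[OF refl])
      (use F_disc_iff[OF t] in \<open>auto simp: k indicator_def log_deriv_def\<close>)
  also have "\<dots> = (LINT x|distr (lborel \<Otimes>\<^sub>M lborel) (borel \<Otimes>\<^sub>M borel) ?FF. k x)"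
    by (rule integral_distr[symmetric]) auto
  also have "\<dots> = (LINT x:disc \<times> disc|lborel \<Otimes>\<^sub>M lborel. kernel t x)"
    unfolding D[symmetric] set_lebesgue_integral_def k ..
  finally show ?thesis using integral_kernel[OF t] by simp
qed

text \<open>Licenses the exchange of the time integral with the integral over pairs; the integrand
  is bounded by \<open>L\<close> and supported in a compact set.\<close>

lemma integrable_log_deriv:
  "integrable (lborel \<Otimes>\<^sub>M lborel) (\<lambda>(t, x). indicator {0..1} t * (indicator (disc \<times> disc) x * Im (log_deriv t x)))"
proof -
  \<comment> \<open>Joint continuity of \<open>F\<close> and \<open>Y\<close> is known for times in
    \<open>{0..1}\<close>. Clamping the time yields continuous functions on the whole space, hence
    measurability.\<close>
  define c where "c t = max 0 (min 1 t)" for t :: real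
  have c: "c t \<in> {0..1}" "t \<in> {0..1} \<Longrightarrow> c t = t" for t by (auto simp: c_def)
  have cm: "continuous_on UNIV c" unfolding c_def by (intro continuous_intros)
  have cF: "continuous_on UNIV (\<lambda>p. F (c (fst p)) (k (snd p)))"
    if "continuous_on UNIV k" for k :: "complex \<times> complex \<Rightarrow> complex"
    by (rule continuous_on_compose2[OF F_continuous_joint, of _ "\<lambda>p. (c (fst p), k (snd p))", simplified])
      (auto intro!: continuous_intros continuous_on_compose2[OF that] continuous_on_compose2[OF cm] simp: c[simplified])
  have cY: "continuous_on UNIV (\<lambda>p. Y (c (fst p)) (F (c (fst p)) (k (snd p))))"
    if "continuous_on UNIV k" for k :: "complex \<times> complex \<Rightarrow> complex"
    by (rule continuous_on_compose2[OF Y_continuous_joint, of _ "\<lambda>p. (c (fst p), F (c (fst p)) (k (snd p)))", simplified])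
      (auto intro!: continuous_intros cF[OF that] continuous_on_compose2[OF cm] simp: c[simplified])
  have k: "continuous_on UNIV (fst :: complex \<times> complex \<Rightarrow> complex)" "continuous_on UNIV (snd :: complex \<times> complex \<Rightarrow> complex)"
    by (intro continuous_intros)+
  note m = borel_measurable_continuous_onI[OF cF[OF k(1)]] borel_measurable_continuous_onI[OF cF[OF k(2)]]
    borel_measurable_continuous_onI[OF cY[OF k(1)]] borel_measurable_continuous_onI[OF cY[OF k(2)]]
  \<comment> \<open>A quotient of continuous functions is Borel measurable also across the zeros of
    the denominator, which takes care of the diagonal.\<close>
  have lm: "(\<lambda>p. Im (log_deriv (c (fst p)) (snd p))) \<in> borel_measurable borel"
    unfolding log_deriv_def using m by measurable
  let ?S = "{0..1::real} \<times> (disc \<times> disc)"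
  have S: "compact ?S" by (intro compact_Times) auto
  have eq: "(\<lambda>(t, x). indicator {0..1} t * (indicator (disc \<times> disc) x * Im (log_deriv t x)))
     = (\<lambda>p. indicator ?S p * Im (log_deriv (c (fst p)) (snd p)))"
    by (auto simp: fun_eq_iff indicator_def c)
  have "integrable lborel (\<lambda>p. indicator ?S p * Im (log_deriv (c (fst p)) (snd p)))"
  proof (rule Bochner_Integration.integrable_bound)
    show "integrable lborel (\<lambda>p. L * indicator ?S p :: real)"
      using S by (intro integrable_mult_right integrable_real_indicator emeasure_compact_finite)
        (auto intro: borel_compact)
    show "(\<lambda>p. indicator ?S p * Im (log_deriv (c (fst p)) (snd p))) \<in> borel_measurable lborel"
      using lm borel_compact[OF S] by (intro borel_measurable_times borel_measurable_indicator) auto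
    show "AE p in lborel. norm (indicator ?S p * Im (log_deriv (c (fst p)) (snd p))) \<le> norm (L * indicator ?S p)"
      using log_deriv_bound[OF c(1)] abs_Im_le_cmod order_trans L0
      by (intro AE_I2) (auto simp: indicator_def intro: order_trans[OF abs_Im_le_cmod])
  qed
  then show ?thesis unfolding eq by (simp add: lborel_prod)
qed

text \<open>After the exchange of integrals, the time slice at \<open>t\<close> contributes
  \<open>- 4 * pi\<close> times the integral of \<open>h t\<close>, and the normalization
  \<open>1 / (2 * pi)\<close> of \<open>theta\<close> leaves \<open>- 2\<close>. As
  \<open>omega 1 \<i> = 1\<close>, the integral of the 2-form is the Lebesgue integral of the
  Hamiltonian.\<close>

proposition rotation_integral_eq:
  assumes f: "\<And>t z. z \<in> disc \<Longrightarrow> F t z = f t z" and H: "\<And>t z. z \<in> disc \<Longrightarrow> h t z = H t z"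
  shows "rotation_integral f = - 2 * calabi_integral H"
proof -
  let ?I = "\<lambda>t x. indicator {0..1} t * (indicator (disc \<times> disc) x * Im (log_deriv t x))"
  have "rotation_integral f = (LINT x|(lborel \<Otimes>\<^sub>M lborel). (LINT t|lborel. ?I t x) / (2 * pi))"
    unfolding rotation_integral_def set_lebesgue_integral_def[of _ X2]
  proof (rule Bochner_Integration.integral_cong[OF refl])
    fix x :: "complex \<times> complex"
    obtain a b where x: "x = (a, b)" by (cases x)
    show "indicator X2 x *\<^sub>R line_integral theta (\<lambda>t. (f t (fst x), f t (snd x))) = (LINT t|lborel. ?I t x) / (2 * pi)"
    proof (cases "x \<in> X2")
      case True
      then have ab: "a \<in> disc" "b \<in> disc" "a \<noteq> b" by (auto simp: X2_def x)
      have "(LINT t|lborel. ?I t x) = (LINT t:{0..1}|lborel. Im (log_deriv t x))"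
        using ab by (simp add: set_lebesgue_integral_def x)
      also have "\<dots> = winding x"
        unfolding winding_def
        by (intro set_borel_integral_eq_integral borel_integrable_atLeastAtMost' continuous_on_Im log_deriv_continuous_time)
          (use ab x in auto)
      finally show ?thesis
        using True line_integral_theta[OF ab(3), of f] f ab by (simp add: x)
    next
      case False
      \<comment> \<open>On the diagonal \<open>log_deriv\<close> is 0 by the convention for
        division, so \<open>disc \<times> disc\<close> can replace \<open>X2\<close>
        pointwise.\<close>
      then have "?I t x = 0" for t
        by (auto simp: X2_def x log_deriv_def indicator_def)
      then have "(LINT t|lborel. ?I t x) = (LINT t|(lborel :: real measure). 0)"
        by (simp only:)
      then show ?thesis using False by simp
    qed
  qed
  also have "\<dots> = (LINT x|(lborel \<Otimes>\<^sub>M lborel). (LINT t|lborel. ?I t x)) / (2 * pi)"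
    by simp
  also have "(LINT x|(lborel \<Otimes>\<^sub>M lborel). (LINT t|lborel. ?I t x)) = (LINT t|lborel. (LINT x|(lborel \<Otimes>\<^sub>M lborel). ?I t x))"
    unfolding lborel_prod by (rule lborel_pair.Fubini_integral[OF integrable_log_deriv])
  also have "\<dots> = (LINT t:{0..1}|lborel. - 4 * pi * (LINT w:disc|lborel. h t w))"
    unfolding set_lebesgue_integral_def[of _ "{0..1}"]
  proof (rule Bochner_Integration.integral_cong[OF refl])
    fix t :: real
    show "(LINT x|(lborel \<Otimes>\<^sub>M lborel). ?I t x) = indicator {0..1} t *\<^sub>R (- 4 * pi * (LINT w:disc|lborel. h t w))"
      using integral_log_deriv[of t]
      by (cases "t \<in> {0..1}") (simp_all add: set_lebesgue_integral_def)
  qed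
  also have "\<dots> = - 4 * pi * (LINT t:{0..1}|lborel. (LINT w:disc|lborel. h t w))"
    by (rule set_integral_mult_right)
  also have "(LINT t:{0..1}|lborel. (LINT w:disc|lborel. h t w)) = calabi_integral H"
    unfolding calabi_integral_def integral_2form_def
    by (intro set_lebesgue_integral_cong allI impI) (auto simp: H omega_eq_det)
  finally show ?thesis by simp
qed

end

section \<open>Well-definedness of both invariants and their proportionality\<close>

theorem theorem1:
  shows "(\<forall>\<phi>\<in>Ham_c. Phi \<phi> = - 2 * Cal \<phi>) \<and>
    (\<forall>\<phi>\<in>Ham_c. \<forall>H f. isotopy_to \<phi> H f \<longrightarrow>
       (LINT x:X2|lborel \<Otimes>\<^sub>M lborel. line_integral theta (\<lambda>t. (f t (fst x), f t (snd x)))) =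
       - 2 * (LINT t:{0..1}|lborel. integral_2form disc (\<lambda>z u v. H t z * omega u v)))"
proof -
  have rot: "rotation_integral f = - 2 * calabi_integral H" if "isotopy_to \<phi> H f" for \<phi> H f
  proof -
    have "hamiltonian_isotopy H f" using that by (simp add: isotopy_to_def)
    then show ?thesis
      by (rule hamiltonian_isotopy_extension) (rule hamiltonian_disc_flow.rotation_integral_eq)
  qed
  have uniq: "rotation_integral f = rotation_integral f'"
    if iso: "isotopy_to \<phi> H f" "isotopy_to \<phi> H' f'" for \<phi> H f H' f'
  proof -
    have H: "hamiltonian_isotopy H f" "hamiltonian_isotopy H' f'" using iso by (auto simp: isotopy_to_def)
    obtain Y F L h where 1: "hamiltonian_disc_flow Y F L h" "\<And>t z. z \<in> disc \<Longrightarrow> F t z = f t z"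
      by (rule hamiltonian_isotopy_extension[OF H(1)], rule that, assumption+)
    obtain Y' F' L' h' where 2: "hamiltonian_disc_flow Y' F' L' h'" "\<And>t z. z \<in> disc \<Longrightarrow> F' t z = f' t z"
      by (rule hamiltonian_isotopy_extension[OF H(2)], rule that, assumption+)
    show ?thesis
    proof (rule rotation_integral_unique)
      show "disc_flow Y F L" using 1(1) by (simp add: hamiltonian_disc_flow_def)
      show "disc_flow Y' F' L'" using 2(1) by (simp add: hamiltonian_disc_flow_def)
      show "f 1 z = f' 1 z" if "z \<in> disc" for z using iso that by (simp add: isotopy_to_def)
    qed (use 1(2) 2(2) in auto)
  qed
  have "Phi \<phi> = - 2 * Cal \<phi>" if \<phi>: "\<phi> \<in> Ham_c" for \<phi>
  proof -
    obtain H f where iso: "isotopy_to \<phi> H f" using \<phi> unfolding Ham_c_def by blast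
    have "Phi \<phi> = rotation_integral f"
      unfolding Phi_def by (rule the_equality) (use iso uniq in blast)+
    moreover have "Cal \<phi> = calabi_integral H"
      unfolding Cal_def
    proof (rule the_equality)
      fix c assume "\<exists>H' f'. isotopy_to \<phi> H' f' \<and> c = calabi_integral H'"
      then obtain H' f' where "isotopy_to \<phi> H' f'" "c = calabi_integral H'" by blast
      then show "c = calabi_integral H" using rot[of \<phi> H' f'] rot[OF iso] uniq[OF iso, of H' f'] by simp
    qed (use iso in blast)
    ultimately show ?thesis using rot[OF iso] by simp
  qed
  moreover have "(LINT x:X2|lborel \<Otimes>\<^sub>M lborel. line_integral theta (\<lambda>t. (f t (fst x), f t (snd x)))) =
       - 2 * (LINT t:{0..1}|lborel. integral_2form disc (\<lambda>z u v. H t z * omega u v))"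
    if "isotopy_to \<phi> H f" for \<phi> H f
    using rot[OF that] by (simp add: rotation_integral_def calabi_integral_def)
  ultimately show ?thesis by blast
qed

end
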